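(* Let $(M^n,g)$ be an oriented Riemannian manifold and let $\alpha\in\Omega^1(M)$ be a smooth real $1$-form. Then the magnetic Hodge Laplacian $\Delta^\alpha$ commutes with the Hodge star operator, i.e. $\Delta^\alpha( *\omega)=*(\Delta^\alpha\omega)$ for every $0\le p\le n$ and every $\omega\in\Omega^p(M,\mathbb{C})$.
   Context: $\Omega^p(M,\mathbb{C})$ is the space of smooth complex-valued differential $p$-forms. The Hodge star $*:\Omega^p(M,\mathbb{C})\to\Omega^{n-p}(M,\mathbb{C})$ is extended complex-linearly. $d^M$ is the exterior derivative and $\delta^M=(-1)^{n(p+1)+1}*d^M*$ (on $p$-forms) its formal adjoint, both extended complex-linearly. For a real $1$-form $\alpha$ with dual vector field $\alpha^\sharp$ (with $\langle\alpha^\sharp,X\rangle=\alpha(X)$), put $d^\alpha:=d^M+i\alpha\wedge$ and $\delta^\alpha:=\delta^M-i\alpha^\sharp\lrcorner$, where $\lrcorner$ is the interior product. The magnetic Hodge Laplacian on $\Omega^p(M,\mathbb{C})$ is $\Delta^\alpha:=d^\alpha\delta^\alpha+\delta^\alpha d^\alpha$. *)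

theory Defs
  imports
    Complex_Main
    "HOL-Analysis.Abstract_Euclidean_Space"
    "HOL-Analysis.Abstract_Topological_Spaces"
    "HOL-Analysis.Derivative"
    "Jordan_Normal_Form.Determinant"
begin

section \<open>Calculus on open subsets of Euclidean n-space\<close>

text \<open>The dimension is a natural number (zero allowed). Points and tangent vectors of Euclidean
  n-space are functions \<^typ>\<open>nat \<Rightarrow> real\<close> that vanish from index n on, as in
  \<^const>\<open>Euclidean_space\<close>. Coordinates are numbered from 0.\<close>

abbreviation Rn :: "nat \<Rightarrow> (nat \<Rightarrow> real) set" where
  "Rn n \<equiv> topspace (Euclidean_space n)"

definition coord_vec :: "nat \<Rightarrow> nat \<Rightarrow> real" where
  "coord_vec i = (\<lambda>k. if k = i then 1 else 0)"

definition partial_deriv :: "nat \<Rightarrow> ((nat \<Rightarrow> real) \<Rightarrow> 'b::real_normed_vector) \<Rightarrow> (nat \<Rightarrow> real) \<Rightarrow> 'b" where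
  "partial_deriv i f y = vector_derivative (\<lambda>t. f (y(i := t))) (at (y i))"

primrec Ck :: "nat \<Rightarrow> (nat \<Rightarrow> real) set \<Rightarrow> nat \<Rightarrow> ((nat \<Rightarrow> real) \<Rightarrow> 'b::real_normed_vector) \<Rightarrow> bool" where
  "Ck n V 0 f \<longleftrightarrow> continuous_map (subtopology (Euclidean_space n) V) euclidean f"
| "Ck n V (Suc k) f \<longleftrightarrow>
     continuous_map (subtopology (Euclidean_space n) V) euclidean f \<and>
     (\<forall>i<n. (\<forall>y\<in>V. (\<lambda>t. f (y(i := t))) differentiable (at (y i))) \<and> Ck n V k (partial_deriv i f))"

text \<open>Only used for V open in Euclidean n-space.\<close>

definition smooth_on :: "nat \<Rightarrow> (nat \<Rightarrow> real) set \<Rightarrow> ((nat \<Rightarrow> real) \<Rightarrow> 'b::real_normed_vector) \<Rightarrow> bool" where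
  "smooth_on n V f \<longleftrightarrow> (\<forall>k. Ck n V k f)"


section \<open>Smooth manifolds\<close>

type_synonym 'a chart = "'a set \<times> ('a \<Rightarrow> nat \<Rightarrow> real)"

abbreviation chart_image :: "'a chart \<Rightarrow> (nat \<Rightarrow> real) set" where
  "chart_image c \<equiv> snd c ` fst c"

definition is_chart :: "nat \<Rightarrow> 'a topology \<Rightarrow> 'a chart \<Rightarrow> bool" where
  "is_chart n T c \<longleftrightarrow>
     openin T (fst c) \<and> openin (Euclidean_space n) (chart_image c) \<and>
     homeomorphic_map (subtopology T (fst c)) (subtopology (Euclidean_space n) (chart_image c)) (snd c)"

definition transition :: "'a chart \<Rightarrow> 'a chart \<Rightarrow> (nat \<Rightarrow> real) \<Rightarrow> nat \<Rightarrow> real" where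
  "transition c c' y = snd c' (inv_into (fst c) (snd c) y)"

definition smooth_manifold :: "nat \<Rightarrow> 'a topology \<Rightarrow> 'a chart set \<Rightarrow> bool" where
  "smooth_manifold n T A \<longleftrightarrow>
     Hausdorff_space T \<and> second_countable T \<and>
     (\<forall>c\<in>A. is_chart n T c) \<and> (\<Union>c\<in>A. fst c) = topspace T \<and>
     (\<forall>c\<in>A. \<forall>c'\<in>A. \<forall>i<n. smooth_on n (snd c ` (fst c \<inter> fst c')) (\<lambda>y. transition c c' y i))"

definition jacobian :: "nat \<Rightarrow> 'a chart \<Rightarrow> 'a chart \<Rightarrow> (nat \<Rightarrow> real) \<Rightarrow> real mat" where
  "jacobian n c c' y = mat n n (\<lambda>(i, j). partial_deriv j (\<lambda>z. transition c c' z i) y)"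

definition transition_deriv ::
  "nat \<Rightarrow> 'a chart \<Rightarrow> 'a chart \<Rightarrow> (nat \<Rightarrow> real) \<Rightarrow> (nat \<Rightarrow> real) \<Rightarrow> nat \<Rightarrow> real" where
  "transition_deriv n c c' y v =
     (\<lambda>i. if i < n then (\<Sum>j<n. partial_deriv j (\<lambda>z. transition c c' z i) y * v j) else 0)"


section \<open>Oriented Riemannian manifolds\<close>

text \<open>As for differential forms below, the metric is the compatible collection of its local
  representatives in the charts of the atlas: \<open>metric M c y\<close> is the inner product at the point with
  coordinates y in the chart c, on coordinate vectors with respect to c. An orientation is a
  continuous choice of an orientation of every tangent space: \<open>orient M c y\<close> is 1 if the coordinate
  frame of c is positively oriented at that point, and -1 otherwise. The charts themselves need not
  be positively oriented.\<close>

record 'a riemannian =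
  mdim :: nat
  points :: "'a topology"
  atlas :: "'a chart set"
  metric :: "'a chart \<Rightarrow> (nat \<Rightarrow> real) \<Rightarrow> (nat \<Rightarrow> real) \<Rightarrow> (nat \<Rightarrow> real) \<Rightarrow> real"
  orient :: "'a chart \<Rightarrow> (nat \<Rightarrow> real) \<Rightarrow> real"

definition inner_product_on :: "nat \<Rightarrow> ((nat \<Rightarrow> real) \<Rightarrow> (nat \<Rightarrow> real) \<Rightarrow> real) \<Rightarrow> bool" where
  "inner_product_on n g \<longleftrightarrow>
     (\<forall>u\<in>Rn n. \<forall>v\<in>Rn n. g u v = g v u) \<and>
     (\<forall>u\<in>Rn n. \<forall>v\<in>Rn n. \<forall>w\<in>Rn n. \<forall>a b. g (\<lambda>i. a * u i + b * v i) w = a * g u w + b * g v w) \<and>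
     (\<forall>u\<in>Rn n. u \<noteq> (\<lambda>_. 0) \<longrightarrow> g u u > 0)"

definition oriented_riemannian_manifold :: "'a riemannian \<Rightarrow> bool" where
  "oriented_riemannian_manifold M \<longleftrightarrow>
     smooth_manifold (mdim M) (points M) (atlas M) \<and>
     \<comment> \<open>metric\<close>
     (\<forall>c\<in>atlas M. \<forall>y\<in>chart_image c. inner_product_on (mdim M) (metric M c y)) \<and>
     (\<forall>c\<in>atlas M. \<forall>u\<in>Rn (mdim M). \<forall>v\<in>Rn (mdim M).
        smooth_on (mdim M) (chart_image c) (\<lambda>y. metric M c y u v)) \<and>
     (\<forall>c\<in>atlas M. \<forall>c'\<in>atlas M. \<forall>x\<in>fst c \<inter> fst c'. \<forall>u\<in>Rn (mdim M). \<forall>v\<in>Rn (mdim M).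
        metric M c (snd c x) u v =
          metric M c' (snd c' x) (transition_deriv (mdim M) c c' (snd c x) u)
                                 (transition_deriv (mdim M) c c' (snd c x) v)) \<and>
     \<comment> \<open>orientation\<close>
     (\<forall>c\<in>atlas M. \<forall>y\<in>chart_image c. orient M c y \<in> {1, -1}) \<and>
     (\<forall>c\<in>atlas M.
        continuous_map (subtopology (Euclidean_space (mdim M)) (chart_image c)) euclideanreal (orient M c)) \<and>
     (\<forall>c\<in>atlas M. \<forall>c'\<in>atlas M. \<forall>x\<in>fst c \<inter> fst c'.
        orient M c (snd c x) = sgn (det (jacobian (mdim M) c c' (snd c x))) * orient M c' (snd c' x))"


section \<open>Differential forms\<close>

text \<open>A p-form on a vector space is an alternating multilinear function of lists of p vectors; it is
  extended by 0 to all other lists.\<close>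

definition alternating_form ::
  "nat \<Rightarrow> nat \<Rightarrow> ((nat \<Rightarrow> real) list \<Rightarrow> 'b::real_normed_vector) \<Rightarrow> bool" where
  "alternating_form n p f \<longleftrightarrow>
     (\<forall>vs. \<not> (length vs = p \<and> set vs \<subseteq> Rn n) \<longrightarrow> f vs = 0) \<and>
     (\<forall>vs k u v a b. length vs = p \<longrightarrow> set vs \<subseteq> Rn n \<longrightarrow> k < p \<longrightarrow> u \<in> Rn n \<longrightarrow> v \<in> Rn n \<longrightarrow>
        f (vs[k := (\<lambda>i. a * u i + b * v i)]) = a *\<^sub>R f (vs[k := u]) + b *\<^sub>R f (vs[k := v])) \<and>
     (\<forall>vs j k. length vs = p \<longrightarrow> j < k \<longrightarrow> k < p \<longrightarrow> vs ! j = vs ! k \<longrightarrow> f vs = 0)"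

text \<open>A differential form is a collection of forms on the chart images, one for every chart of the
  atlas, compatible under pullback by the transition maps (as in Bott and Tu, Differential Forms
  in Algebraic Topology). It is extended by 0 outside the chart images, so that
  equal forms are equal functions. Real forms have \<open>'b = real\<close>, complex forms have
  \<open>'b = complex\<close>.\<close>

type_synonym ('a, 'b) form = "'a chart \<Rightarrow> (nat \<Rightarrow> real) \<Rightarrow> (nat \<Rightarrow> real) list \<Rightarrow> 'b"

definition forms :: "'a riemannian \<Rightarrow> nat \<Rightarrow> ('a, 'b::real_normed_vector) form set" where
  "forms M p = {\<omega>.
     (\<forall>c y. \<not> (c \<in> atlas M \<and> y \<in> chart_image c) \<longrightarrow> \<omega> c y = (\<lambda>_. 0)) \<and>
     (\<forall>c\<in>atlas M. \<forall>y\<in>chart_image c. alternating_form (mdim M) p (\<omega> c y)) \<and>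
     (\<forall>c\<in>atlas M. \<forall>vs. set vs \<subseteq> Rn (mdim M) \<longrightarrow> smooth_on (mdim M) (chart_image c) (\<lambda>y. \<omega> c y vs)) \<and>
     (\<forall>c\<in>atlas M. \<forall>c'\<in>atlas M. \<forall>x\<in>fst c \<inter> fst c'. \<forall>vs. set vs \<subseteq> Rn (mdim M) \<longrightarrow>
        \<omega> c (snd c x) vs = \<omega> c' (snd c' x) (map (transition_deriv (mdim M) c c' (snd c x)) vs))}"

definition remove_nth :: "nat \<Rightarrow> 'c list \<Rightarrow> 'c list" where
  "remove_nth k xs = take k xs @ drop (Suc k) xs"

text \<open>\<open>(d\<omega>)(v\<^sub>0, \<dots>, v\<^sub>p) = \<Sum>\<^sub>k (-1)\<^sup>k D\<^bsub>v\<^sub>k\<^esub> (\<omega>(v\<^sub>0, \<dots>, v\<^sub>p without v\<^sub>k))\<close> for constant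
  coordinate vector fields; in every chart this is
  \<open>d(f dx\<^sup>I) = \<Sum>\<^sub>i (\<partial_deriv>\<^sub>i f) dx\<^sup>i \<and> dx\<^sup>I\<close>.\<close>

definition ext_deriv :: "'a riemannian \<Rightarrow> ('a, 'b::real_normed_vector) form \<Rightarrow> ('a, 'b) form" where
  "ext_deriv M \<omega> = (\<lambda>c y vs.
     if c \<in> atlas M \<and> y \<in> chart_image c \<and> set vs \<subseteq> Rn (mdim M)
     then \<Sum>k<length vs. (-1) ^ k *\<^sub>R
            (\<Sum>i<mdim M. (vs ! k) i *\<^sub>R partial_deriv i (\<lambda>z. \<omega> c z (remove_nth k vs)) y)
     else 0)"

text \<open>The exterior product of a real 1-form with a form.\<close>

definition wedge1 :: "('a, real) form \<Rightarrow> ('a, 'b::real_normed_vector) form \<Rightarrow> ('a, 'b) form" where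
  "wedge1 \<alpha> \<omega> = (\<lambda>c y vs.
     \<Sum>k<length vs. (-1) ^ k *\<^sub>R (\<alpha> c y [vs ! k] *\<^sub>R \<omega> c y (remove_nth k vs)))"


section \<open>Operators depending on the metric\<close>

definition sharp_covector ::
  "'a riemannian \<Rightarrow> 'a chart \<Rightarrow> (nat \<Rightarrow> real) \<Rightarrow> ((nat \<Rightarrow> real) \<Rightarrow> real) \<Rightarrow> nat \<Rightarrow> real" where
  "sharp_covector M c y a =
     (THE v. v \<in> Rn (mdim M) \<and> (\<forall>w\<in>Rn (mdim M). metric M c y v w = a w))"

definition sharp :: "'a riemannian \<Rightarrow> ('a, real) form \<Rightarrow> 'a chart \<Rightarrow> (nat \<Rightarrow> real) \<Rightarrow> nat \<Rightarrow> real" where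
  "sharp M \<alpha> c y = sharp_covector M c y (\<lambda>w. \<alpha> c y [w])"

definition interior ::
  "('a chart \<Rightarrow> (nat \<Rightarrow> real) \<Rightarrow> nat \<Rightarrow> real) \<Rightarrow> ('a, 'b::real_normed_vector) form \<Rightarrow> ('a, 'b) form" where
  "interior X \<omega> = (\<lambda>c y vs. \<omega> c y (X c y # vs))"

text \<open>The Riemannian volume form (on lists of \<open>mdim M\<close> vectors); it is 1 on positively oriented
  orthonormal frames.\<close>

definition volume_form :: "'a riemannian \<Rightarrow> ('a, real) form" where
  "volume_form M = (\<lambda>c y vs.
     orient M c y
     * sqrt (det (mat (mdim M) (mdim M) (\<lambda>(i, j). metric M c y (coord_vec i) (coord_vec j))))
     * det (mat (mdim M) (mdim M) (\<lambda>(i, j). (vs ! j) i)))"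

text \<open>Hodge star on p-forms. With \<open>I\<close> ranging over all p-tuples of indices,
  \<open>(*\<omega>)(w\<^sub>1, \<dots>, w\<^sub>q) = 1/p! \<Sum>\<^sub>I \<omega>((dx\<^bsup>I\<^esup>)\<^sup>\<sharp>) vol(\<partial_deriv>\<^bsub>I\<^esub>, w\<^sub>1, \<dots>, w\<^sub>q)\<close> where \<open>p + q = n\<close>, that is,
  \<open>(*\<omega>)\<^bsub>J\<^esub> = 1/p! \<omega>\<^bsup>I\<^esup> vol\<^bsub>IJ\<^esub>\<close> with indices raised by the metric. The contraction does
  not depend on the frame, so \<open>(*\<omega>)(e\<^bsub>p+1\<^esub>, \<dots>, e\<^sub>n) = \<omega>(e\<^sub>1, \<dots>, e\<^sub>p)\<close> for positively oriented
  orthonormal frames, which is the convention \<open>\<eta> \<and> *\<omega> = \<langle>\<eta>, \<omega>\<rangle> vol\<close>. The formula is complex-linear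
  in \<open>\<omega>\<close>. In degree \<open>p > n\<close>, where every form is zero, it gives zero.\<close>

definition hodge :: "'a riemannian \<Rightarrow> nat \<Rightarrow> ('a, 'b::real_normed_vector) form \<Rightarrow> ('a, 'b) form" where
  "hodge M p \<omega> = (\<lambda>c y vs.
     if c \<in> atlas M \<and> y \<in> chart_image c \<and> set vs \<subseteq> Rn (mdim M) \<and> p + length vs = mdim M
     then (1 / fact p) *\<^sub>R
       (\<Sum>I\<in>{I. length I = p \<and> set I \<subseteq> {..<mdim M}}.
          volume_form M c y (map coord_vec I @ vs) *\<^sub>R
          \<omega> c y (map (\<lambda>i. sharp_covector M c y (\<lambda>w. w i)) I))
     else 0)"

text \<open>The codifferential on p-forms. For \<open>p = 0\<close> it is zero, because \<open>hodge\<close> is zero in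
  degree n + 1.\<close>

definition codiff :: "'a riemannian \<Rightarrow> nat \<Rightarrow> ('a, 'b::real_normed_vector) form \<Rightarrow> ('a, 'b) form" where
  "codiff M p \<omega> = (\<lambda>c y vs.
     (-1) ^ (mdim M * (p + 1) + 1) *\<^sub>R
     hodge M (mdim M - p + 1) (ext_deriv M (hodge M p \<omega>)) c y vs)"


section \<open>The magnetic Hodge Laplacian\<close>

definition magnetic_d ::
  "'a riemannian \<Rightarrow> ('a, real) form \<Rightarrow> ('a, complex) form \<Rightarrow> ('a, complex) form" where
  "magnetic_d M \<alpha> \<omega> = (\<lambda>c y vs. ext_deriv M \<omega> c y vs + \<i> * wedge1 \<alpha> \<omega> c y vs)"

definition magnetic_codiff ::
  "'a riemannian \<Rightarrow> ('a, real) form \<Rightarrow> nat \<Rightarrow> ('a, complex) form \<Rightarrow> ('a, complex) form" where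
  "magnetic_codiff M \<alpha> p \<omega> =
     (\<lambda>c y vs. codiff M p \<omega> c y vs - \<i> * interior (sharp M \<alpha>) \<omega> c y vs)"

text \<open>The explicit argument p is the degree of the form.\<close>

definition magnetic_laplacian ::
  "'a riemannian \<Rightarrow> ('a, real) form \<Rightarrow> nat \<Rightarrow> ('a, complex) form \<Rightarrow> ('a, complex) form" where
  "magnetic_laplacian M \<alpha> p \<omega> = (\<lambda>c y vs.
     magnetic_d M \<alpha> (magnetic_codiff M \<alpha> p \<omega>) c y vs
     + magnetic_codiff M \<alpha> (p + 1) (magnetic_d M \<alpha> \<omega>) c y vs)"

end

theory Submission
  imports Defs
begin

text \<open>Up to sign, the Hodge star intertwines the two first-order operators: on p-forms
  \<open>\<delta>\<^sup>\<alpha> * = (-1)\<^sup>p\<^sup>+\<^sup>1 * d\<^sup>\<alpha>\<close> and \<open>d\<^sup>\<alpha> * = (-1)\<^sup>p * \<delta>\<^sup>\<alpha>\<close> (\<open>magnetic_codiff_hodge\<close>,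
  \<open>magnetic_d_hodge\<close>). Applying both in a row turns \<open>d\<^sup>\<alpha> \<delta>\<^sup>\<alpha> *\<close> into \<open>* \<delta>\<^sup>\<alpha> d\<^sup>\<alpha>\<close> and
  \<open>\<delta>\<^sup>\<alpha> d\<^sup>\<alpha> *\<close> into \<open>* d\<^sup>\<alpha> \<delta>\<^sup>\<alpha>\<close>, all signs cancelling: the star exchanges the two summands of
  the magnetic Laplacian.

  The part of these relations that contains derivatives is the definition of \<open>\<delta>\<close> together with
  \<open>** = (-1)\<^sup>p\<^sup>(\<^sup>n\<^sup>-\<^sup>p\<^sup>)\<close> (\<open>star_star\<close>). The part that contains \<open>\<alpha>\<close> is linear algebra at a single point:
  \<open>*(a \<and> f) = (-1)\<^sup>p a\<^sup>\<sharp> \<lrcorner> *f\<close> (\<open>star_wedge\<close>) and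
  \<open>*(X \<lrcorner> f) = (-1)\<^sup>p X\<^sup>\<flat> \<and> *f\<close> for f of degree p + 1 (\<open>star_interior\<close>). The first
  holds by moving one contracted index to the front; the second because
  \<open>X\<^sup>\<flat> \<and> vol\<close>, a form of degree n + 1, is zero. These two identities also give \<open>star_star\<close> by
  induction on the degree, since every (p + 1)-form f is a combination of products:
  \<open>(p + 1) f = \<Sum>\<^sub>k dx\<^sup>k \<and> (\<partial>\<^sub>k \<lrcorner> f)\<close>. Raised indices are handled by the vectors \<open>(dx\<^sup>j)\<^sup>\<sharp>\<close>, the dual basis of the
  coordinate vectors with respect to the metric.

  What remains is regularity. The operators are iterated, so the results of each of them have to be
  smooth alternating forms again. For the star this rests on the smoothness of
  \<open>sqrt (det g\<^sub>i\<^sub>j)\<close>, of the inverse matrix of \<open>g\<^sub>i\<^sub>j\<close> (Cramer's rule) and of the orientation sign,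
  which is locally constant. All operators act in each chart separately, and so do
  the arguments.\<close>

section \<open>Smooth functions on open subsets of Euclidean space\<close>

lemma continuous_map_Euclidean_subtopology_iff:
  assumes "V \<subseteq> Rn n"
  shows "continuous_map (subtopology (Euclidean_space n) V) euclidean f \<longleftrightarrow> continuous_on V f"
proof -
  have "subtopology (Euclidean_space n) V = top_of_set V"
    using assms by (simp add: Euclidean_space_def euclidean_product_topology subtopology_subtopology
        topspace_Euclidean_space Int_absorb1)
  then show ?thesis by simp
qed

lemma openin_Euclidean_space_iff: "openin (Euclidean_space n) V \<longleftrightarrow> openin (top_of_set (Rn n)) V"
  by (simp add: Euclidean_space_def euclidean_product_topology)

text \<open>This is where openness enters: a partial derivative at a point of V is determined by the values
  on V alone.\<close>

lemma eventually_coordinate_line_in: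
  assumes V: "openin (Euclidean_space n) V" and y: "y \<in> V" and i: "i < n"
  shows "\<forall>\<^sub>F t in nhds (y i). y(i := t) \<in> V"
proof -
  obtain S where S: "open S" "V = Rn n \<inter> S"
    using V by (auto simp: openin_Euclidean_space_iff openin_open)
  have "continuous_on UNIV (\<lambda>t. y(i := t))"
  proof (rule continuous_on_coordinatewise_then_product)
    show "continuous_on UNIV (\<lambda>t. (y(i := t)) j)" for j
      by (cases "j = i") simp_all
  qed
  then have "open ((\<lambda>t. y(i := t)) -` S)"
    by (rule open_vimage[OF S(1)])
  moreover have "y i \<in> (\<lambda>t. y(i := t)) -` S" using y S by simp
  ultimately have ev: "\<forall>\<^sub>F t in nhds (y i). y(i := t) \<in> S"
    by (auto simp: eventually_nhds)
  have line: "y(i := t) \<in> Rn n" for t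
    using y i unfolding S(2) by (simp add: topspace_Euclidean_space)
  show ?thesis
    using ev line unfolding S(2) by (simp only: Int_iff simp_thms)
qed

lemma has_partial_deriv_cong:
  assumes V: "openin (Euclidean_space n) V" and y: "y \<in> V" and i: "i < n"
    and eq: "\<And>z. z \<in> V \<Longrightarrow> f z = g z"
    and f: "((\<lambda>t. f (y(i := t))) has_vector_derivative D) (at (y i))"
  shows "((\<lambda>t. g (y(i := t))) has_vector_derivative D) (at (y i))"
proof -
  have "\<forall>\<^sub>F t in nhds (y i). f (y(i := t)) = g (y(i := t))"
    using eventually_coordinate_line_in[OF V y i] by (rule eventually_mono) (rule eq)
  then show ?thesis
    using f eq[OF y] has_vector_derivative_cong_ev[of UNIV "\<lambda>t. f (y(i := t))" "\<lambda>t. g (y(i := t))" "y i" D]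
    by (simp only: fun_upd_triv UNIV_I simp_thms)
qed

lemma Ck_imp_continuous_on:
  "V \<subseteq> Rn n \<Longrightarrow> Ck n V k f \<Longrightarrow> continuous_on V f"
  by (cases k) (auto simp: continuous_map_Euclidean_subtopology_iff)

lemma Ck_SucD:
  assumes "Ck n V (Suc k) f" "i < n"
  shows "y \<in> V \<Longrightarrow> ((\<lambda>t. f (y(i := t))) has_vector_derivative partial_deriv i f y) (at (y i))"
    and "Ck n V k (partial_deriv i f)"
  using assms by (auto simp: partial_deriv_def vector_derivative_works)

lemma Ck_cong:
  assumes "openin (Euclidean_space n) V" "\<And>z. z \<in> V \<Longrightarrow> f z = g z" "Ck n V k f"
  shows "Ck n V k g"
  using assms(2,3)
proof (induction k arbitrary: f g)
  case 0
  then show ?case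
    using openin_subset[OF assms(1)]
    by (simp add: continuous_map_Euclidean_subtopology_iff cong: continuous_on_cong)
next
  case (Suc k)
  have V: "V \<subseteq> Rn n" using openin_subset[OF assms(1)] .
  have c: "continuous_on V g"
    using Ck_imp_continuous_on[OF V Suc.prems(2)] Suc.prems(1) by (simp cong: continuous_on_cong)
  have D: "((\<lambda>t. g (y(i := t))) has_vector_derivative partial_deriv i f y) (at (y i))"
    if "y \<in> V" "i < n" for y i
    by (rule has_partial_deriv_cong[where f=f, OF assms(1) that Suc.prems(1) Ck_SucD(1)[OF Suc.prems(2) that(2,1)]])
  then have "partial_deriv i f y = partial_deriv i g y" if "y \<in> V" "i < n" for y i
    using that unfolding partial_deriv_def[of i g] by (metis vector_derivative_at)
  then have "Ck n V k (partial_deriv i g)" if "i < n" for i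
    using Suc.IH[of "partial_deriv i f" "partial_deriv i g"] Ck_SucD(2)[OF Suc.prems(2)] that by blast
  with c D V show ?case
    by (auto simp: continuous_map_Euclidean_subtopology_iff intro: differentiableI_vector)
qed

text \<open>The closure properties below are proved by exhibiting the derivatives: D is any family of
  functions that agrees with the partial derivatives on V, so that the induction hypothesis can be
  applied to a formula for D.\<close>

lemma Ck_SucI:
  assumes V: "openin (Euclidean_space n) V"
    and c: "continuous_on V f"
    and D: "\<And>i y. i < n \<Longrightarrow> y \<in> V \<Longrightarrow> ((\<lambda>t. f (y(i := t))) has_vector_derivative D i y) (at (y i))"
    and k: "\<And>i. i < n \<Longrightarrow> Ck n V k (D i)"
  shows "Ck n V (Suc k) f"
proof -
  have "Ck n V k (partial_deriv i f)" if "i < n" for i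
    using that by (intro Ck_cong[OF V _ k]) (auto simp: partial_deriv_def vector_derivative_at[OF D])
  then show ?thesis
    using c openin_subset[OF V]
    by (auto simp: continuous_map_Euclidean_subtopology_iff intro: differentiableI_vector D)
qed

lemma Ck_Suc_imp_Ck: "Ck n V (Suc k) f \<Longrightarrow> Ck n V k f"
  by (induction k arbitrary: f) auto

lemma Ck_const:
  assumes V: "openin (Euclidean_space n) V"
  shows "Ck n V k (\<lambda>_. c)"
proof (induction k arbitrary: c)
  case (Suc k)
  show ?case by (rule Ck_SucI[OF V, where D="\<lambda>_ _. 0"]) (auto intro: Suc)
qed simp

lemma Ck_add:
  assumes V: "openin (Euclidean_space n) V"
  shows "Ck n V k f \<Longrightarrow> Ck n V k g \<Longrightarrow> Ck n V k (\<lambda>y. f y + g y)"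
proof (induction k arbitrary: f g)
  case 0
  then show ?case
    using openin_subset[OF V] by (auto simp: continuous_map_Euclidean_subtopology_iff intro!: continuous_intros)
next
  case (Suc k)
  show ?case
  proof (rule Ck_SucI[OF V])
    show "continuous_on V (\<lambda>y. f y + g y)"
      using Suc.prems[THEN Ck_imp_continuous_on[OF openin_subset[OF V]]] by (intro continuous_intros)
    show "((\<lambda>t. f (y(i := t)) + g (y(i := t))) has_vector_derivative
        partial_deriv i f y + partial_deriv i g y) (at (y i))" if "i < n" "y \<in> V" for i y
      by (intro has_vector_derivative_add Ck_SucD(1)[OF Suc.prems(1) that] Ck_SucD(1)[OF Suc.prems(2) that])
    show "Ck n V k (\<lambda>y. partial_deriv i f y + partial_deriv i g y)" if "i < n" for i
      by (intro Suc.IH Ck_SucD(2)[OF Suc.prems(1) that] Ck_SucD(2)[OF Suc.prems(2) that])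
  qed
qed

text \<open>The product rule, at once for scalar multiplication and for multiplication.\<close>

lemma Ck_bilinear:
  assumes V: "openin (Euclidean_space n) V" and h: "bounded_bilinear h"
  shows "Ck n V k f \<Longrightarrow> Ck n V k g \<Longrightarrow> Ck n V k (\<lambda>y. h (f y) (g y))"
proof (induction k arbitrary: f g)
  case 0
  then show ?case
    using openin_subset[OF V]
    by (auto simp: continuous_map_Euclidean_subtopology_iff intro!: bounded_bilinear.continuous_on[OF h])
next
  case (Suc k)
  show ?case
  proof (rule Ck_SucI[OF V])
    show "continuous_on V (\<lambda>y. h (f y) (g y))"
      using Suc.prems[THEN Ck_imp_continuous_on[OF openin_subset[OF V]]]
      by (intro bounded_bilinear.continuous_on[OF h])
    show "((\<lambda>t. h (f (y(i := t))) (g (y(i := t)))) has_vector_derivative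
        h (f y) (partial_deriv i g y) + h (partial_deriv i f y) (g y)) (at (y i))"
      if "i < n" "y \<in> V" for i y
      using bounded_bilinear.has_vector_derivative[OF h Ck_SucD(1)[OF Suc.prems(1) that] Ck_SucD(1)[OF Suc.prems(2) that]]
      by (simp only: fun_upd_triv)
    show "Ck n V k (\<lambda>y. h (f y) (partial_deriv i g y) + h (partial_deriv i f y) (g y))" if "i < n" for i
      by (intro Ck_add[OF V] Suc.IH Ck_SucD(2)[OF Suc.prems(1) that] Ck_SucD(2)[OF Suc.prems(2) that]
          Ck_Suc_imp_Ck[OF Suc.prems(1)] Ck_Suc_imp_Ck[OF Suc.prems(2)])
  qed
qed

text \<open>The derivative \<open>- f' / f\<^sup>2\<close> is a polynomial in \<open>f'\<close> and \<open>1 / f\<close> itself, so the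
  induction on the order of differentiability closes. The same happens for the square root, whose
  derivative is \<open>f' / (2 sqrt f)\<close>.\<close>

lemma Ck_inverse:
  fixes f :: "(nat \<Rightarrow> real) \<Rightarrow> real"
  assumes V: "openin (Euclidean_space n) V" and nz: "\<And>y. y \<in> V \<Longrightarrow> f y \<noteq> 0"
  shows "Ck n V k f \<Longrightarrow> Ck n V k (\<lambda>y. inverse (f y))"
proof (induction k)
  case 0
  then show ?case
    using openin_subset[OF V] nz by (auto simp: continuous_map_Euclidean_subtopology_iff intro!: continuous_intros)
next
  case (Suc k)
  show ?case
  proof (rule Ck_SucI[OF V])
    show "continuous_on V (\<lambda>y. inverse (f y))"
      using Ck_imp_continuous_on[OF openin_subset[OF V] Suc.prems] nz by (intro continuous_intros) auto
    show "((\<lambda>t. inverse (f (y(i := t)))) has_vector_derivative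
        (-1) * (inverse (f y) * (partial_deriv i f y * inverse (f y)))) (at (y i))"
      if "i < n" "y \<in> V" for i y
      using DERIV_inverse'[OF Ck_SucD(1)[OF Suc.prems that, folded has_real_derivative_iff_has_vector_derivative]] nz[OF that(2)]
      by (simp add: has_real_derivative_iff_has_vector_derivative[symmetric] mult_ac)
    show "Ck n V k (\<lambda>y. (-1) * (inverse (f y) * (partial_deriv i f y * inverse (f y))))" if "i < n" for i
      by (intro Ck_bilinear[OF V bounded_bilinear_mult] Ck_const[OF V] Ck_SucD(2)[OF Suc.prems that]
          Suc.IH Ck_Suc_imp_Ck[OF Suc.prems])
  qed
qed

lemma Ck_sqrt:
  fixes f :: "(nat \<Rightarrow> real) \<Rightarrow> real"
  assumes V: "openin (Euclidean_space n) V" and pos: "\<And>y. y \<in> V \<Longrightarrow> f y > 0"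
  shows "Ck n V k f \<Longrightarrow> Ck n V k (\<lambda>y. sqrt (f y))"
proof (induction k)
  case 0
  then show ?case
    using openin_subset[OF V] by (auto simp: continuous_map_Euclidean_subtopology_iff intro!: continuous_intros)
next
  case (Suc k)
  show ?case
  proof (rule Ck_SucI[OF V])
    show "continuous_on V (\<lambda>y. sqrt (f y))"
      using Ck_imp_continuous_on[OF openin_subset[OF V] Suc.prems] by (intro continuous_intros)
    show "((\<lambda>t. sqrt (f (y(i := t)))) has_vector_derivative
        (inverse (sqrt (f y)) * (1/2)) * partial_deriv i f y) (at (y i))"
      if "i < n" "y \<in> V" for i y
    proof -
      have "((\<lambda>t. f (y(i := t))) has_real_derivative partial_deriv i f y) (at (y i))"
        using Ck_SucD(1)[OF Suc.prems that] by (simp only: has_real_derivative_iff_has_vector_derivative)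
      moreover have "(sqrt has_real_derivative inverse (sqrt (f y)) * (1/2)) (at (f (y(i := y i))))"
        using DERIV_real_sqrt[OF pos[OF that(2)]] by (simp only: fun_upd_triv times_divide_eq_right mult_1_right)
      ultimately show ?thesis
        unfolding has_real_derivative_iff_has_vector_derivative[symmetric]
        using DERIV_chain2[of sqrt _ "\<lambda>t. f (y(i := t))" "y i"] by blast
    qed
    have "Ck n V k (\<lambda>y. inverse (sqrt (f y)))"
      using pos Suc.IH[OF Ck_Suc_imp_Ck[OF Suc.prems]] by (intro Ck_inverse[OF V]) (auto simp: order_less_imp_not_eq2)
    then show "Ck n V k (\<lambda>y. (inverse (sqrt (f y)) * (1/2)) * partial_deriv i f y)" if "i < n" for i
      by (intro Ck_bilinear[OF V bounded_bilinear_mult] Ck_const[OF V] Ck_SucD(2)[OF Suc.prems that])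
  qed
qed

lemma smooth_on_cong:
  "openin (Euclidean_space n) V \<Longrightarrow> (\<And>z. z \<in> V \<Longrightarrow> f z = g z) \<Longrightarrow> smooth_on n V f \<Longrightarrow> smooth_on n V g"
  unfolding smooth_on_def using Ck_cong by blast

lemma smooth_on_const: "openin (Euclidean_space n) V \<Longrightarrow> smooth_on n V (\<lambda>_. c)"
  unfolding smooth_on_def by (simp add: Ck_const)

lemma smooth_on_add:
  "openin (Euclidean_space n) V \<Longrightarrow> smooth_on n V f \<Longrightarrow> smooth_on n V g \<Longrightarrow> smooth_on n V (\<lambda>y. f y + g y)"
  unfolding smooth_on_def by (simp add: Ck_add)

lemma smooth_on_scaleR:
  "openin (Euclidean_space n) V \<Longrightarrow> smooth_on n V f \<Longrightarrow> smooth_on n V g \<Longrightarrow> smooth_on n V (\<lambda>y. f y *\<^sub>R g y)"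
  unfolding smooth_on_def by (simp add: Ck_bilinear[OF _ bounded_bilinear_scaleR])

lemma smooth_on_mult:
  fixes f :: "_ \<Rightarrow> 'b::real_normed_algebra"
  shows "openin (Euclidean_space n) V \<Longrightarrow> smooth_on n V f \<Longrightarrow> smooth_on n V g \<Longrightarrow> smooth_on n V (\<lambda>y. f y * g y)"
  unfolding smooth_on_def by (simp add: Ck_bilinear[OF _ bounded_bilinear_mult])

lemma smooth_on_inverse:
  fixes f :: "_ \<Rightarrow> real"
  shows "openin (Euclidean_space n) V \<Longrightarrow> (\<And>y. y \<in> V \<Longrightarrow> f y \<noteq> 0) \<Longrightarrow> smooth_on n V f \<Longrightarrow>
    smooth_on n V (\<lambda>y. inverse (f y))"
  unfolding smooth_on_def by (simp add: Ck_inverse)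

lemma smooth_on_sqrt:
  fixes f :: "_ \<Rightarrow> real"
  shows "openin (Euclidean_space n) V \<Longrightarrow> (\<And>y. y \<in> V \<Longrightarrow> f y > 0) \<Longrightarrow> smooth_on n V f \<Longrightarrow>
    smooth_on n V (\<lambda>y. sqrt (f y))"
  unfolding smooth_on_def by (simp add: Ck_sqrt)

lemma smooth_on_sum:
  assumes V: "openin (Euclidean_space n) V" and "\<And>j. j \<in> S \<Longrightarrow> smooth_on n V (f j)"
  shows "smooth_on n V (\<lambda>y. \<Sum>j\<in>S. f j y)"
  using assms(2) by (induction S rule: infinite_finite_induct) (auto intro: smooth_on_const[OF V] smooth_on_add[OF V])

lemma smooth_on_prod:
  fixes f :: "_ \<Rightarrow> _ \<Rightarrow> real"
  assumes V: "openin (Euclidean_space n) V" and "\<And>j. j \<in> S \<Longrightarrow> smooth_on n V (f j)"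
  shows "smooth_on n V (\<lambda>y. \<Prod>j\<in>S. f j y)"
  using assms(2) by (induction S rule: infinite_finite_induct) (auto intro: smooth_on_const[OF V] smooth_on_mult[OF V])

text \<open>By the Leibniz formula the determinant is a polynomial in the entries.\<close>

lemma smooth_on_det:
  fixes a :: "_ \<Rightarrow> nat \<Rightarrow> nat \<Rightarrow> real"
  assumes V: "openin (Euclidean_space n) V"
    and a: "\<And>i j. i < m \<Longrightarrow> j < m \<Longrightarrow> smooth_on n V (\<lambda>y. a y i j)"
  shows "smooth_on n V (\<lambda>y. det (mat m m (\<lambda>(i, j). a y i j)))"
proof -
  have "smooth_on n V (\<lambda>y. \<Sum>\<pi>\<in>{\<pi>. \<pi> permutes {0..<m}}. signof \<pi> * (\<Prod>i = 0..<m. a y i (\<pi> i)))"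
    by (intro smooth_on_sum[OF V] smooth_on_mult[OF V] smooth_on_const[OF V] smooth_on_prod[OF V] a)
      (auto dest: permutes_in_image)
  moreover have "det (mat m m (\<lambda>(i, j). a y i j)) =
      (\<Sum>\<pi>\<in>{\<pi>. \<pi> permutes {0..<m}}. signof \<pi> * (\<Prod>i = 0..<m. a y i (\<pi> i)))" for y
    by (subst det_def'[of _ m]) (auto intro!: sum.cong prod.cong dest: permutes_in_image)
  ultimately show ?thesis by simp
qed

lemma smooth_on_partial_deriv: "smooth_on n V f \<Longrightarrow> i < n \<Longrightarrow> smooth_on n V (partial_deriv i f)"
  unfolding smooth_on_def using Ck_SucD(2) by blast

lemma smooth_on_has_partial_deriv:
  assumes "smooth_on n V f" "i < n" "y \<in> V"
  shows "((\<lambda>t. f (y(i := t))) has_vector_derivative partial_deriv i f y) (at (y i))"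
proof -
  have "Ck n V (Suc 0) f" using assms(1) unfolding smooth_on_def by blast
  then show ?thesis using assms(2,3) by (rule Ck_SucD(1))
qed

lemma partial_deriv_add:
  assumes "smooth_on n V f" "smooth_on n V g" "i < n" "y \<in> V"
  shows "partial_deriv i (\<lambda>z. f z + g z) y = partial_deriv i f y + partial_deriv i g y"
  unfolding partial_deriv_def[of i "\<lambda>z. f z + g z"]
  by (rule vector_derivative_at[OF has_vector_derivative_add[OF
        smooth_on_has_partial_deriv[OF assms(1,3,4)] smooth_on_has_partial_deriv[OF assms(2-)]]])

lemma partial_deriv_linear:
  assumes h: "bounded_linear h" and "smooth_on n V f" "i < n" "y \<in> V"
  shows "partial_deriv i (\<lambda>z. h (f z)) y = h (partial_deriv i f y)"
  unfolding partial_deriv_def[of i "\<lambda>z. h (f z)"]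
  by (rule vector_derivative_at[OF bounded_linear.has_vector_derivative[OF h smooth_on_has_partial_deriv[OF assms(2-)]]])

text \<open>A continuous function with values 1 and -1 is locally constant. This makes the orientation
  sign, which is only given to be continuous, a smooth function.\<close>

lemma smooth_on_sign:
  fixes s :: "_ \<Rightarrow> real"
  assumes V: "openin (Euclidean_space n) V" and c: "continuous_on V s"
    and s: "\<And>y. y \<in> V \<Longrightarrow> s y \<in> {1, -1}"
  shows "smooth_on n V s"
  unfolding smooth_on_def
proof
  fix k
  have D: "((\<lambda>t. s (y(i := t))) has_vector_derivative 0) (at (y i))" if i: "i < n" and y: "y \<in> V" for i y
  proof -
    define W where "W = {z \<in> V. s z \<in> ball (s y) 1}"
    have "openin (top_of_set V) (V \<inter> s -` ball (s y) 1)"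
      using c by (intro continuous_openin_preimage_gen) auto
    then have "openin (Euclidean_space n) W"
      using V openin_trans[of V "V \<inter> s -` ball (s y) 1" "Rn n"]
      unfolding openin_Euclidean_space_iff W_def by (simp only: Int_def vimage_def mem_Collect_eq)
    moreover have "y \<in> W" using y by (simp add: W_def)
    moreover have "s y = s z" if "z \<in> W" for z
      using s[OF y] s[of z] that by (auto simp: W_def dist_real_def)
    ultimately show ?thesis
      by (rule has_partial_deriv_cong[where f="\<lambda>_. s y", OF _ _ i _ has_vector_derivative_const])
  qed
  show "Ck n V k s"
  proof (cases k)
    case 0
    with c openin_subset[OF V] show ?thesis by (simp add: continuous_map_Euclidean_subtopology_iff)
  next
    case (Suc m)
    then show ?thesis
      by (simp only:) (intro Ck_SucI[OF V c, where D="\<lambda>_ _. 0"] D Ck_const[OF V])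
  qed
qed

section \<open>Alternating forms\<close>

lemma Rn_iff: "v \<in> Rn n \<longleftrightarrow> (\<forall>i\<ge>n. v i = 0)"
  by (simp add: topspace_Euclidean_space)

lemma Rn_combination: "u \<in> Rn n \<Longrightarrow> v \<in> Rn n \<Longrightarrow> (\<lambda>i. a * u i + b * v i) \<in> Rn n"
  by (simp add: Rn_iff)

lemma Rn_zero: "(\<lambda>_. 0) \<in> Rn n"
  by (simp add: Rn_iff)

lemma Rn_sum: "(\<And>j. j \<in> S \<Longrightarrow> w j \<in> Rn n) \<Longrightarrow> (\<lambda>i. \<Sum>j\<in>S. c j * w j i) \<in> Rn n"
  by (simp add: Rn_iff)

lemma coord_vec_in_Rn: "i < n \<Longrightarrow> coord_vec i \<in> Rn n"
  by (auto simp: Rn_iff coord_vec_def)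

lemma Rn_expand:
  assumes "u \<in> Rn n"
  shows "u = (\<lambda>k. \<Sum>i<n. u i * coord_vec i k)"
proof
  fix k
  have "(\<Sum>i<n. u i * coord_vec i k) = (\<Sum>i<n. if i = k then u k else 0)"
    by (intro sum.cong) (auto simp: coord_vec_def)
  also have "\<dots> = u k"
    using assms by (auto simp: Rn_iff)
  finally show "u k = (\<Sum>i<n. u i * coord_vec i k)" by simp
qed

lemma alternating_form_outside:
  "alternating_form n p f \<Longrightarrow> \<not> (length vs = p \<and> set vs \<subseteq> Rn n) \<Longrightarrow> f vs = 0"
  unfolding alternating_form_def by blast

lemma alternating_form_update:
  assumes "alternating_form n p f" "length vs = p" "set vs \<subseteq> Rn n" "k < p" "u \<in> Rn n" "v \<in> Rn n"
  shows "f (vs[k := (\<lambda>i. a * u i + b * v i)]) = a *\<^sub>R f (vs[k := u]) + b *\<^sub>R f (vs[k := v])"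
  using assms(1)[unfolded alternating_form_def, THEN conjunct2, THEN conjunct1] assms(2-) by blast

lemma alternating_form_equal_entries:
  assumes "alternating_form n p f" "length vs = p" "j < k" "k < p" "vs ! j = vs ! k"
  shows "f vs = 0"
  using assms(1)[unfolded alternating_form_def, THEN conjunct2, THEN conjunct2] assms(2-) by blast

text \<open>Multilinearity with the argument singled out by concatenation of lists. If some other argument
  is not in \<open>Rn n\<close>, or the number of arguments is wrong, all three values are zero.\<close>

lemma alternating_form_linear:
  assumes f: "alternating_form n p f" and uv: "u \<in> Rn n" "v \<in> Rn n"
  shows "f (us @ (\<lambda>i. a * u i + b * v i) # ws) = a *\<^sub>R f (us @ u # ws) + b *\<^sub>R f (us @ v # ws)"
proof (cases "length (us @ u # ws) = p \<and> set (us @ ws) \<subseteq> Rn n")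
  case True
  have "f ((us @ u # ws)[length us := (\<lambda>i. a * u i + b * v i)]) =
      a *\<^sub>R f ((us @ u # ws)[length us := u]) + b *\<^sub>R f ((us @ u # ws)[length us := v])"
    using True uv by (intro alternating_form_update[OF f]) auto
  then show ?thesis by (simp only: list_update_length)
next
  case False
  then have "f (us @ x # ws) = 0" for x
    by (intro alternating_form_outside[OF f]) auto
  then show ?thesis by simp
qed

lemma alternating_form_repeat:
  assumes f: "alternating_form n p f"
  shows "f (us @ x # ws @ x # zs) = 0"
proof (cases "length (us @ x # ws @ x # zs) = p")
  case True
  then show ?thesis
    by (intro alternating_form_equal_entries[OF f True, of "length us" "length us + 1 + length ws"])
      (auto simp: nth_append)
next
  case False
  then show ?thesis using alternating_form_outside[OF f] by blast
qed

lemma alternating_form_zero_vector: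
  assumes f: "alternating_form n p f"
  shows "f (us @ (\<lambda>_. 0) # ws) = 0"
  using alternating_form_linear[OF f Rn_zero Rn_zero, of us 0 0 ws] by simp

lemma alternating_form_sum:
  assumes f: "alternating_form n p f" and w: "\<And>j. j \<in> S \<Longrightarrow> w j \<in> Rn n"
  shows "f (us @ (\<lambda>i. \<Sum>j\<in>S. c j * w j i) # ws) = (\<Sum>j\<in>S. c j *\<^sub>R f (us @ w j # ws))"
  using w
proof (induction S rule: infinite_finite_induct)
  case (insert x S)
  have "f (us @ (\<lambda>i. c x * w x i + 1 * (\<Sum>j\<in>S. c j * w j i)) # ws) =
      c x *\<^sub>R f (us @ w x # ws) + 1 *\<^sub>R f (us @ (\<lambda>i. \<Sum>j\<in>S. c j * w j i) # ws)"
    using insert.prems by (intro alternating_form_linear[OF f] Rn_sum) auto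
  with insert show ?case by simp
qed (auto simp: alternating_form_zero_vector[OF f])

lemma alternating_form_expand:
  assumes f: "alternating_form n p f" and u: "u \<in> Rn n"
  shows "f (us @ u # ws) = (\<Sum>i<n. u i *\<^sub>R f (us @ coord_vec i # ws))"
  using alternating_form_sum[OF f, of "{..<n}" coord_vec us u ws] Rn_expand[OF u]
  by (simp add: coord_vec_in_Rn)

text \<open>Polarisation: expand the form at (..., a + b, a + b, ...), where it is zero.\<close>

lemma alternating_form_swap:
  assumes f: "alternating_form n p f"
  shows "f (us @ a # b # ws) = - f (us @ b # a # ws)"
proof (cases "a \<in> Rn n \<and> b \<in> Rn n")
  case True
  let ?s = "\<lambda>i. 1 * a i + 1 * b i"
  have s: "?s \<in> Rn n" using True by (intro Rn_combination) auto
  have "0 = f (us @ ?s # ?s # ws)"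
    using alternating_form_repeat[OF f, of us ?s "[]" ws] by simp
  also have "\<dots> = f (us @ a # ?s # ws) + f (us @ b # ?s # ws)"
    using alternating_form_linear[OF f, of a b us 1 1 "?s # ws"] True by simp
  also have "\<dots> = (f (us @ a # a # ws) + f (us @ a # b # ws)) + (f (us @ b # a # ws) + f (us @ b # b # ws))"
    using alternating_form_linear[OF f, of a b "us @ [a]" 1 1 ws]
      alternating_form_linear[OF f, of a b "us @ [b]" 1 1 ws] True by simp
  also have "\<dots> = f (us @ a # b # ws) + f (us @ b # a # ws)"
    using alternating_form_repeat[OF f, of us a "[]" ws] alternating_form_repeat[OF f, of us b "[]" ws] by simp
  finally show ?thesis by (simp add: eq_neg_iff_add_eq_0)
next
  case False
  then show ?thesis using alternating_form_outside[OF f] by auto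
qed

lemma alternating_form_move_to_front:
  assumes f: "alternating_form n p f"
  shows "f (us @ x # ws) = (-1) ^ length us *\<^sub>R f (x # us @ ws)"
proof (induction us arbitrary: ws rule: rev_induct)
  case (snoc u us)
  have "f ((us @ [u]) @ x # ws) = - f (us @ x # u # ws)"
    using alternating_form_swap[OF f, of us u x ws] by simp
  then show ?case using snoc[of "u # ws"] by simp
qed simp

lemma remove_nth_append: "remove_nth (length us) (us @ x # ws) = us @ ws"
  by (simp add: remove_nth_def)

lemma length_remove_nth: "k < length vs \<Longrightarrow> length (remove_nth k vs) = length vs - 1"
  by (simp add: remove_nth_def)

lemma set_remove_nth: "set vs \<subseteq> A \<Longrightarrow> set (remove_nth k vs) \<subseteq> A"
  by (auto simp: remove_nth_def dest: in_set_takeD in_set_dropD)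

lemma map_remove_nth: "map h (remove_nth k vs) = remove_nth k (map h vs)"
  by (simp add: remove_nth_def take_map drop_map)

lemma alternating_form_nth_to_front:
  assumes f: "alternating_form n p f" and k: "k < length vs"
  shows "(-1) ^ k *\<^sub>R f (vs ! k # remove_nth k vs) = f vs"
proof -
  have "vs = take k vs @ vs ! k # drop (Suc k) vs" using k by (simp add: id_take_nth_drop)
  then have "f vs = (-1) ^ length (take k vs) *\<^sub>R f (vs ! k # take k vs @ drop (Suc k) vs)"
    using alternating_form_move_to_front[OF f] by metis
  with k show ?thesis by (simp add: remove_nth_def min_def)
qed

lemma alternating_form_map_nth_to_front:
  assumes f: "alternating_form n p f" and k: "k < length I"
  shows "f (map h I @ ws) = (-1) ^ k *\<^sub>R f (h (I ! k) # map h (remove_nth k I) @ ws)"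
proof -
  have "map h I @ ws = map h (take k I) @ h (I ! k) # (map h (drop (Suc k) I) @ ws)"
    by (subst id_take_nth_drop[OF k]) simp
  then show ?thesis
    using alternating_form_move_to_front[OF f, of "map h (take k I)" "h (I ! k)" "map h (drop (Suc k) I) @ ws"] k
    by (simp add: remove_nth_def)
qed

lemma remove_nth_update_same: "remove_nth k (vs[k := u]) = remove_nth k vs"
  by (simp add: remove_nth_def)

lemma remove_nth_update_other:
  assumes "j < length vs" "k < length vs" "j \<noteq> k"
  shows "remove_nth k (vs[j := u]) = (remove_nth k vs)[(if j < k then j else j - 1) := u]"
  using assms by (auto simp: remove_nth_def take_update_swap drop_update_swap list_update_append list_update_beyond min_def)

text \<open>The common shape of the exterior derivative (\<open>F v\<close> is the derivative in the direction v) and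
  of the exterior product with a covector (\<open>F v\<close> is multiplication by the value at v). If the
  argument x occurs at the positions i < j, then \<open>F\<close> still sees x twice in every term other than the
  i-th and the j-th; these two contain the same vectors, with x moved by j - i - 1 places, and
  cancel.\<close>

lemma alternating_form_alternation:
  fixes F :: "(nat \<Rightarrow> real) \<Rightarrow> (nat \<Rightarrow> real) list \<Rightarrow> 'b::real_normed_vector"
  assumes alt: "\<And>v. v \<in> Rn n \<Longrightarrow> alternating_form n p (F v)"
    and lin: "\<And>u v a b ws. u \<in> Rn n \<Longrightarrow> v \<in> Rn n \<Longrightarrow> set ws \<subseteq> Rn n \<Longrightarrow>
      F (\<lambda>i. a * u i + b * v i) ws = a *\<^sub>R F u ws + b *\<^sub>R F v ws"
    and A: "\<And>vs. length vs = Suc p \<Longrightarrow> set vs \<subseteq> Rn n \<Longrightarrow>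
      A vs = (\<Sum>k<Suc p. (-1) ^ k *\<^sub>R F (vs ! k) (remove_nth k vs))"
    and A0: "\<And>vs. \<not> (length vs = Suc p \<and> set vs \<subseteq> Rn n) \<Longrightarrow> A vs = 0"
  shows "alternating_form n (Suc p) A"
  unfolding alternating_form_def
proof (intro conjI allI impI)
  fix vs :: "(nat \<Rightarrow> real) list"
  assume "\<not> (length vs = Suc p \<and> set vs \<subseteq> Rn n)"
  then show "A vs = 0" by (rule A0)
next
  fix vs :: "(nat \<Rightarrow> real) list" and j u v and a b :: real
  assume vs: "length vs = Suc p" "set vs \<subseteq> Rn n" and j: "j < Suc p" and uv: "u \<in> Rn n" "v \<in> Rn n"
  let ?w = "\<lambda>i. a * u i + b * v i"
  let ?t = "\<lambda>k x. (-1) ^ k *\<^sub>R F (vs[j := x] ! k) (remove_nth k (vs[j := x]))"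
  have Aupd: "A (vs[j := x]) = (\<Sum>k<Suc p. ?t k x)" if "x \<in> Rn n" for x
  proof (rule A)
    have "set (vs[j := x]) \<subseteq> insert x (set vs)" by (rule set_update_subset_insert)
    also have "\<dots> \<subseteq> Rn n" using vs(2) that by (simp only: insert_subset simp_thms)
    finally show "set (vs[j := x]) \<subseteq> Rn n" .
  qed (simp add: vs(1))
  have "?t k ?w = a *\<^sub>R ?t k u + b *\<^sub>R ?t k v" if k: "k < Suc p" for k
  proof (cases "k = j")
    case True
    show ?thesis
      using True k vs(1) lin[OF uv set_remove_nth[OF vs(2)]] by (simp add: remove_nth_update_same algebra_simps)
  next
    case False
    let ?j = "if j < k then j else j - 1"
    let ?r = "remove_nth k vs"
    have "vs ! k \<in> Rn n" using vs k by auto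
    then have "F (vs ! k) (?r[?j := ?w]) = a *\<^sub>R F (vs ! k) (?r[?j := u]) + b *\<^sub>R F (vs ! k) (?r[?j := v])"
      using uv vs k j False length_remove_nth[of k vs]
      by (intro alternating_form_update[OF alt] set_remove_nth) auto
    then show ?thesis
      using False k j vs(1) by (simp add: remove_nth_update_other algebra_simps)
  qed
  then have "(\<Sum>k<Suc p. ?t k ?w) = (\<Sum>k<Suc p. a *\<^sub>R ?t k u + b *\<^sub>R ?t k v)"
    by (intro sum.cong refl) (simp only: lessThan_iff)
  then show "A (vs[j := ?w]) = a *\<^sub>R A (vs[j := u]) + b *\<^sub>R A (vs[j := v])"
    by (simp only: Aupd[OF Rn_combination[OF uv]] Aupd[OF uv(1)] Aupd[OF uv(2)] scaleR_sum_right sum.distrib)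
next
  fix vs :: "(nat \<Rightarrow> real) list" and i j
  assume len_vs: "length vs = Suc p" and ij: "i < j" "j < Suc p" "vs ! i = vs ! j"
  show "A vs = 0"
  proof (cases "set vs \<subseteq> Rn n")
    case True
    with len_vs have vs: "length vs = Suc p" "set vs \<subseteq> Rn n" by simp_all
    define x where "x = vs ! i"
    obtain us ws zs where split: "vs = us @ x # ws @ x # zs" and len: "length us = i" "length ws = j - Suc i"
    proof
      \<comment> \<open>cut the list at the positions i and j\<close>
      have "drop (Suc i) vs = take (j - Suc i) (drop (Suc i) vs) @ drop (Suc i) vs ! (j - Suc i) # drop (Suc (j - Suc i)) (drop (Suc i) vs)"
        using ij vs by (intro id_take_nth_drop) simp
      then show "vs = take i vs @ x # take (j - Suc i) (drop (Suc i) vs) @ x # drop (Suc j) vs"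
        using ij vs id_take_nth_drop[of i vs] by (simp add: x_def)
    qed (use ij vs in auto)
    have x: "x \<in> Rn n" using vs split by auto
    let ?t = "\<lambda>k. (-1) ^ k *\<^sub>R F (vs ! k) (remove_nth k vs)"
    have zero: "?t k = 0" if "k < Suc p" "k \<noteq> i" "k \<noteq> j" for k
    proof -
      have "vs ! k \<in> Rn n" using vs that by auto
      note f = alt[OF this]
      have l: "length (remove_nth k vs) = p" using vs that length_remove_nth[of k vs] by simp
      let ?i = "if i < k then i else i - 1" and ?j = "if j < k then j else j - 1"
      have "remove_nth k vs ! ?i = vs ! i" "remove_nth k vs ! ?j = vs ! j"
        using that ij vs by (auto simp: remove_nth_def nth_append min_def)
      then have "F (vs ! k) (remove_nth k vs) = 0"
        using that ij by (intro alternating_form_equal_entries[OF f l, of ?i ?j]) auto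
      then show ?thesis by simp
    qed
    have ri: "remove_nth i vs = us @ ws @ x # zs"
      using remove_nth_append[of us x "ws @ x # zs"] by (simp add: split len)
    have rj: "remove_nth j vs = us @ x # ws @ zs"
      using remove_nth_append[of "us @ x # ws" x zs] ij by (simp add: split len)
    have "?t i = (-1) ^ (i + (i + (j - Suc i))) *\<^sub>R F x (x # us @ ws @ zs)"
      using alternating_form_move_to_front[OF alt[OF x], of "us @ ws" x zs]
      by (simp add: ri len x_def[symmetric] power_add)
    moreover have "?t j = (-1) ^ (j + i) *\<^sub>R F x (x # us @ ws @ zs)"
      using alternating_form_move_to_front[OF alt[OF x], of us x "ws @ zs"]
      by (simp add: rj len ij(3)[symmetric] x_def[symmetric] power_add)
    moreover have "(-1::real) ^ (j + i) = - ((-1) ^ (i + (i + (j - Suc i))))"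
    proof -
      have "j + i = Suc (i + (i + (j - Suc i)))" using ij by simp
      then show ?thesis by (simp only: power_Suc mult_minus1)
    qed
    ultimately have "?t i + ?t j = 0" by simp
    moreover have "(\<Sum>k<Suc p. ?t k) = (\<Sum>k\<in>{i, j}. ?t k)"
      using ij zero by (intro sum.mono_neutral_right) auto
    ultimately show "A vs = 0" using ij A[OF vs] by simp
  qed (simp add: A0)
qed

text \<open>After expansion in the coordinate basis two of the more than n arguments coincide.\<close>

lemma alternating_form_above_dimension:
  assumes f: "alternating_form n p f" and p: "n < p"
  shows "f vs = 0"
proof -
  have "f (ws @ map coord_vec I) = 0" if "set ws \<subseteq> Rn n" "set I \<subseteq> {..<n}" "length ws + length I = p" for ws I
    using that
  proof (induction ws arbitrary: I rule: rev_induct)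
    case Nil
    have "\<not> distinct I"
    proof
      assume "distinct I"
      then have "length I \<le> card {..<n}"
        using Nil.prems(2) by (metis card_mono distinct_card finite_lessThan)
      with Nil p show False by simp
    qed
    then obtain xs ys zs y where "I = xs @ [y] @ ys @ [y] @ zs"
      using not_distinct_decomp by blast
    then show ?case
      using alternating_form_repeat[OF f, of "map coord_vec xs" "coord_vec y" "map coord_vec ys" "map coord_vec zs"] by simp
  next
    case (snoc w ws)
    have "f (ws @ coord_vec i # map coord_vec I) = 0" if "i < n" for i
      using snoc.IH[of "i # I"] snoc.prems that by simp
    then show ?case
      using alternating_form_expand[OF f, of w ws "map coord_vec I"] snoc.prems by simp
  qed
  from this[of vs "[]"] show ?thesis
    using alternating_form_outside[OF f, of vs] by auto
qed

lemma alternating_form_scaleR: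
  assumes f: "alternating_form n p f"
  shows "alternating_form n p (\<lambda>vs. c *\<^sub>R f vs)"
  unfolding alternating_form_def
proof (intro conjI allI impI)
  fix vs :: "(nat \<Rightarrow> real) list" and k u v and a b :: real
  assume "length vs = p" "set vs \<subseteq> Rn n" "k < p" "u \<in> Rn n" "v \<in> Rn n"
  then show "c *\<^sub>R f (vs[k := \<lambda>i. a * u i + b * v i]) =
      a *\<^sub>R c *\<^sub>R f (vs[k := u]) + b *\<^sub>R c *\<^sub>R f (vs[k := v])"
    by (simp only: alternating_form_update[OF f] scaleR_add_right scaleR_left_commute)
qed (simp_all add: alternating_form_outside[OF f] alternating_form_equal_entries[OF f])

definition covector_wedge ::
  "((nat \<Rightarrow> real) \<Rightarrow> real) \<Rightarrow> ((nat \<Rightarrow> real) list \<Rightarrow> 'b::real_normed_vector) \<Rightarrow> (nat \<Rightarrow> real) list \<Rightarrow> 'b" where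
  "covector_wedge a f vs = (\<Sum>k<length vs. (-1) ^ k *\<^sub>R (a (vs ! k) *\<^sub>R f (remove_nth k vs)))"

text \<open>Linear forms on \<open>Rn n\<close>, extended by zero; stated through alternating 1-forms so that the
  expansion lemmas for multilinear forms apply to them.\<close>

definition covector :: "nat \<Rightarrow> ((nat \<Rightarrow> real) \<Rightarrow> real) \<Rightarrow> bool" where
  "covector n a \<longleftrightarrow> alternating_form n 1 (\<lambda>vs. if length vs = 1 then a (hd vs) else 0)"

lemma covector_iff:
  "covector n a \<longleftrightarrow> (\<forall>v. v \<notin> Rn n \<longrightarrow> a v = 0) \<and>
     (\<forall>u\<in>Rn n. \<forall>v\<in>Rn n. \<forall>s t. a (\<lambda>i. s * u i + t * v i) = s * a u + t * a v)" (is "?L = ?R")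
proof
  assume L: ?L
  note f = L[unfolded covector_def]
  have "a v = 0" if "v \<notin> Rn n" for v
    using alternating_form_outside[OF f, of "[v]"] that by simp
  moreover have "a (\<lambda>i. s * u i + t * v i) = s * a u + t * a v" if "u \<in> Rn n" "v \<in> Rn n" for u v s t
    using alternating_form_linear[OF f that, of "[]" s t "[]"] by simp
  ultimately show ?R by blast
next
  assume R: ?R
  show ?L
    unfolding covector_def alternating_form_def
  proof (intro conjI allI impI)
    fix vs :: "(nat \<Rightarrow> real) list" assume "\<not> (length vs = 1 \<and> set vs \<subseteq> Rn n)"
    then show "(if length vs = 1 then a (hd vs) else 0) = 0"
      using R by (cases vs) auto
  qed (use R in \<open>auto simp: length_Suc_conv\<close>)
qed

lemma alternating_form_Cons:
  assumes f: "alternating_form n (Suc p) f" and X: "X \<in> Rn n"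
  shows "alternating_form n p (\<lambda>vs. f (X # vs))"
  unfolding alternating_form_def
proof (intro conjI allI impI)
  fix vs :: "(nat \<Rightarrow> real) list" and k u v and a b :: real
  assume vs: "length vs = p" "set vs \<subseteq> Rn n" and k: "k < p" and uv: "u \<in> Rn n" "v \<in> Rn n"
  show "f (X # vs[k := \<lambda>i. a * u i + b * v i]) = a *\<^sub>R f (X # vs[k := u]) + b *\<^sub>R f (X # vs[k := v])"
    using alternating_form_linear[OF f uv, of "X # take k vs" a b "drop (Suc k) vs"] k vs
    by (simp add: upd_conv_take_nth_drop)
next
  fix vs :: "(nat \<Rightarrow> real) list" and j k
  assume vs: "length vs = p" and jk: "j < k" "k < p" "vs ! j = vs ! k"
  have "length (X # vs) = Suc p" "Suc j < Suc k" "Suc k < Suc p"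
    "(X # vs) ! Suc j = (X # vs) ! Suc k"
    using vs jk X by auto
  then show "f (X # vs) = 0"
    by (rule alternating_form_equal_entries[OF f])
qed (use X alternating_form_outside[OF f] in auto)

lemma alternating_covector_wedge:
  assumes a: "covector n a" and f: "alternating_form n p f"
  shows "alternating_form n (Suc p) (covector_wedge a f)"
proof (rule alternating_form_alternation[where F="\<lambda>v ws. a v *\<^sub>R f ws"])
  show "alternating_form n p (\<lambda>ws. a v *\<^sub>R f ws)" for v
    by (rule alternating_form_scaleR[OF f])
  show "a (\<lambda>i. s * u i + t * v i) *\<^sub>R f ws = s *\<^sub>R (a u *\<^sub>R f ws) + t *\<^sub>R (a v *\<^sub>R f ws)"
    if "u \<in> Rn n" "v \<in> Rn n" for u v s t ws
    using a that by (simp add: covector_iff algebra_simps)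
  fix vs :: "(nat \<Rightarrow> real) list"
  show "covector_wedge a f vs = (\<Sum>k<Suc p. (-1) ^ k *\<^sub>R (a (vs ! k) *\<^sub>R f (remove_nth k vs)))" if "length vs = Suc p"
    using that by (simp add: covector_wedge_def)
  assume vs: "\<not> (length vs = Suc p \<and> set vs \<subseteq> Rn n)"
  have "a (vs ! k) *\<^sub>R f (remove_nth k vs) = 0" if k: "k < length vs" for k
  proof (rule ccontr)
    assume nz: "a (vs ! k) *\<^sub>R f (remove_nth k vs) \<noteq> 0"
    then have "vs ! k \<in> Rn n" using a by (auto simp: covector_iff)
    moreover have "length (remove_nth k vs) = p \<and> set (remove_nth k vs) \<subseteq> Rn n"
      by (rule ccontr) (use nz alternating_form_outside[OF f, of "remove_nth k vs"] in simp)
    moreover have "set vs = insert (vs ! k) (set (remove_nth k vs))"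
      using k by (subst id_take_nth_drop[OF k]) (auto simp: remove_nth_def)
    ultimately show False using vs length_remove_nth[OF k] k by auto
  qed
  then show "covector_wedge a f vs = 0"
    unfolding covector_wedge_def by (intro sum.neutral ballI) simp
qed

section \<open>Multi-indices, determinants of columns and Gram matrices\<close>

definition multi_indices :: "nat \<Rightarrow> nat \<Rightarrow> nat list set" where
  "multi_indices n p = {I. length I = p \<and> set I \<subseteq> {..<n}}"

lemma finite_multi_indices: "finite (multi_indices n p)"
  using finite_lists_length_eq[of "{..<n}" p] by (simp add: multi_indices_def conj_commute)

lemma nth_multi_indices: "I \<in> multi_indices n p \<Longrightarrow> k < p \<Longrightarrow> I ! k < n"
  using subsetD[OF _ nth_mem, of I "{..<n}" k] by (simp add: multi_indices_def)

text \<open>A multi-index of length p + 1 consists of its k-th entry and the rest. The right-hand side does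
  not contain k: this is how the p + 1 terms of an alternation, summed over all multi-indices,
  become equal.\<close>

lemma sum_multi_indices_remove_nth:
  assumes "k < Suc p"
  shows "(\<Sum>I\<in>multi_indices n (Suc p). H (I ! k) (remove_nth k I)) = (\<Sum>i<n. \<Sum>J\<in>multi_indices n p. H i J)"
proof -
  have "(\<Sum>I\<in>multi_indices n (Suc p). H (I ! k) (remove_nth k I)) =
      (\<Sum>(i, J)\<in>{..<n} \<times> multi_indices n p. H i J)"
  proof (rule sum.reindex_bij_witness[where i = "\<lambda>(i, J). take k J @ i # drop k J" and j = "\<lambda>I. (I ! k, remove_nth k I)"], goal_cases)
    case (1 I)
    then show ?case using assms by (simp add: multi_indices_def remove_nth_def id_take_nth_drop[symmetric] min_def)
  next
    case (2 I)
    then have "set (remove_nth k I) \<subseteq> {..<n}" by (intro set_remove_nth) (simp add: multi_indices_def)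
    with 2 assms nth_multi_indices[OF 2 assms] show ?case
      by (simp add: multi_indices_def length_remove_nth)
  next
    case (3 x)
    then show ?case using assms by (auto simp: multi_indices_def remove_nth_def nth_append min_def)
  next
    case (4 x)
    then show ?case using assms
      by (auto simp: multi_indices_def dest: in_set_takeD in_set_dropD)
  qed auto
  also have "\<dots> = (\<Sum>i<n. \<Sum>J\<in>multi_indices n p. H i J)"
    by (simp add: sum.cartesian_product)
  finally show ?thesis .
qed

definition columns_mat :: "nat \<Rightarrow> (nat \<Rightarrow> real) list \<Rightarrow> real mat" where
  "columns_mat n vs = mat n n (\<lambda>(i, j). (vs ! j) i)"

lemma columns_mat_carrier: "columns_mat n vs \<in> carrier_mat n n"
  by (simp add: columns_mat_def)

lemma det_columns_mat:
  "det (columns_mat n vs) = (\<Sum>\<pi> | \<pi> permutes {0..<n}. signof \<pi> * (\<Prod>j\<in>{0..<n}. (vs ! j) (\<pi> j)))"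
  by (subst det_col[OF columns_mat_carrier])
    (auto simp: columns_mat_def atLeast0LessThan intro!: sum.cong prod.cong dest: permutes_in_image)

lemma det_columns_mat_update:
  assumes "length vs = n" "k < n"
  shows "det (columns_mat n (vs[k := (\<lambda>i. a * u i + b * v i)])) =
    a * det (columns_mat n (vs[k := u])) + b * det (columns_mat n (vs[k := v]))"
proof -
  have split: "(\<Prod>j\<in>{0..<n}. (vs[k := x] ! j) (\<pi> j)) = x (\<pi> k) * (\<Prod>j\<in>{0..<n} - {k}. (vs ! j) (\<pi> j))" for x \<pi>
    using assms by (subst prod.remove[of _ k]) (auto intro!: prod.cong)
  show ?thesis
    unfolding det_columns_mat split sum_distrib_left sum.distrib[symmetric]
    by (intro sum.cong refl) (simp add: algebra_simps)
qed

lemma det_columns_mat_equal: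
  assumes "j < k" "k < n" "vs ! j = vs ! k"
  shows "det (columns_mat n vs) = 0"
proof (rule det_identical_columns[OF columns_mat_carrier])
  show "Matrix.col (columns_mat n vs) j = Matrix.col (columns_mat n vs) k"
    using assms by (auto simp: columns_mat_def)
qed (use assms in auto)

text \<open>If the indices are distinct, the matrix A of the columns is orthogonal, so the square of its
  determinant is \<open>det (A\<^sup>T A) = 1\<close>; the sign of the permutation does not have to be known.\<close>

lemma det_coordinate_columns_squared:
  assumes I: "I \<in> multi_indices n n"
  shows "(det (columns_mat n (map coord_vec I)))\<^sup>2 = (if distinct I then 1 else 0)"
proof (cases "distinct I")
  case True
  let ?A = "columns_mat n (map coord_vec I)"
  have len: "length I = n" and I': "\<And>j. j < n \<Longrightarrow> I ! j < n"
    using I nth_multi_indices[OF I] by (auto simp: multi_indices_def)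
  have "transpose_mat ?A * ?A = 1\<^sub>m n"
  proof (rule eq_matI)
    fix j k assume "j < dim_row (1\<^sub>m n)" "k < dim_col (1\<^sub>m n)"
    then have jk: "j < n" "k < n" by auto
    have "(transpose_mat ?A * ?A) $$ (j, k) = (\<Sum>i = 0..<n. coord_vec (I ! j) i * coord_vec (I ! k) i)"
      using jk len by (simp add: columns_mat_def scalar_prod_def)
    also have "\<dots> = (\<Sum>i = 0..<n. if i = I ! j then (if j = k then 1 else 0) else 0)"
      using jk len True by (intro sum.cong) (auto simp: coord_vec_def nth_eq_iff_index_eq)
    also have "\<dots> = (1\<^sub>m n) $$ (j, k)"
      using jk I' by simp
    finally show "(transpose_mat ?A * ?A) $$ (j, k) = (1\<^sub>m n :: real mat) $$ (j, k)" .
  qed (auto simp: columns_mat_def)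
  then have "det (transpose_mat ?A) * det ?A = 1"
    using det_mult[of "transpose_mat ?A" n ?A] columns_mat_carrier by (simp add: det_one)
  with True show ?thesis
    by (simp add: det_transpose[OF columns_mat_carrier] power2_eq_square)
next
  case False
  then obtain j k where "j < length I" "k < length I" "j \<noteq> k" "I ! j = I ! k"
    by (auto simp: distinct_conv_nth)
  then obtain j k where "j < k" "k < length I" "I ! j = I ! k"
    by (metis nat_neq_iff)
  then show ?thesis
    using False I by (simp add: multi_indices_def det_columns_mat_equal[of j k])
qed

definition gram :: "nat \<Rightarrow> ((nat \<Rightarrow> real) \<Rightarrow> (nat \<Rightarrow> real) \<Rightarrow> real) \<Rightarrow> real mat" where
  "gram n g = mat n n (\<lambda>(i, j). g (coord_vec i) (coord_vec j))"

lemma gram_carrier: "gram n g \<in> carrier_mat n n"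
  by (simp add: gram_def)

lemma covector_sum:
  assumes a: "covector n a" and w: "\<And>j. j \<in> S \<Longrightarrow> w j \<in> Rn n"
  shows "a (\<lambda>i. \<Sum>j\<in>S. c j * w j i) = (\<Sum>j\<in>S. c j * a (w j))"
  using alternating_form_sum[OF a[unfolded covector_def] w, where us="[]" and ws="[]" and c=c] by simp

lemma covector_expand:
  assumes a: "covector n a" and u: "u \<in> Rn n"
  shows "a u = (\<Sum>i<n. u i * a (coord_vec i))"
  using covector_sum[OF a, of "{..<n}" coord_vec u] Rn_expand[OF u] by (simp add: coord_vec_in_Rn)

context
  fixes n :: nat and g :: "(nat \<Rightarrow> real) \<Rightarrow> (nat \<Rightarrow> real) \<Rightarrow> real"
  assumes g: "inner_product_on n g"
begin

lemma inner_product_commute: "u \<in> Rn n \<Longrightarrow> v \<in> Rn n \<Longrightarrow> g u v = g v u"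
  using g unfolding inner_product_on_def by simp

lemma inner_product_linear_left:
  "u \<in> Rn n \<Longrightarrow> v \<in> Rn n \<Longrightarrow> w \<in> Rn n \<Longrightarrow> g (\<lambda>i. a * u i + b * v i) w = a * g u w + b * g v w"
  using g unfolding inner_product_on_def by simp

lemma inner_product_linear_right:
  "u \<in> Rn n \<Longrightarrow> v \<in> Rn n \<Longrightarrow> w \<in> Rn n \<Longrightarrow> g w (\<lambda>i. a * u i + b * v i) = a * g w u + b * g w v"
  by (simp add: inner_product_commute[of w] inner_product_linear_left Rn_combination)

lemma inner_product_pos: "u \<in> Rn n \<Longrightarrow> u \<noteq> (\<lambda>_. 0) \<Longrightarrow> g u u > 0"
  using g unfolding inner_product_on_def by simp

lemma covector_inner_product:
  "X \<in> Rn n \<Longrightarrow> covector n (\<lambda>w. if w \<in> Rn n then g X w else 0)"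
  by (auto simp: covector_iff inner_product_linear_right Rn_combination)

lemma inner_product_sum_right:
  assumes "X \<in> Rn n" and w: "\<And>j. j \<in> S \<Longrightarrow> w j \<in> Rn n"
  shows "g X (\<lambda>i. \<Sum>j\<in>S. c j * w j i) = (\<Sum>j\<in>S. c j * g X (w j))"
  using covector_sum[OF covector_inner_product[OF assms(1)] w, where c=c] w
  by (simp add: Rn_sum)

lemma inner_product_sum_left:
  assumes "X \<in> Rn n" and w: "\<And>j. j \<in> S \<Longrightarrow> w j \<in> Rn n"
  shows "g (\<lambda>i. \<Sum>j\<in>S. c j * w j i) X = (\<Sum>j\<in>S. c j * g (w j) X)"
proof -
  have "g (\<lambda>i. \<Sum>j\<in>S. c j * w j i) X = g X (\<lambda>i. \<Sum>j\<in>S. c j * w j i)"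
    using assms by (intro inner_product_commute Rn_sum) auto
  then show ?thesis
    using assms by (simp add: inner_product_sum_right inner_product_commute[of X])
qed

text \<open>A vector u in the kernel of the Gram matrix satisfies \<open>g u u = 0\<close>.\<close>

lemma det_gram_nonzero: "det (gram n g) \<noteq> 0"
proof
  assume "det (gram n g) = 0"
  then obtain v where v: "v \<in> carrier_vec n" "v \<noteq> 0\<^sub>v n" "gram n g *\<^sub>v v = 0\<^sub>v n"
    using det_0_iff_vec_prod_zero_field[OF gram_carrier] by blast
  define u where "u i = (if i < n then vec_index v i else 0)" for i
  have u: "u \<in> Rn n" by (simp add: Rn_iff u_def)
  have z: "g (coord_vec i) u = 0" if i: "i < n" for i
  proof -
    have "g (coord_vec i) u = (\<Sum>j<n. u j * g (coord_vec i) (coord_vec j))"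
      using covector_expand[OF covector_inner_product[OF coord_vec_in_Rn[OF i]] u] u
      by (simp add: coord_vec_in_Rn)
    also have "\<dots> = vec_index (gram n g *\<^sub>v v) i"
      using i v(1) by (auto simp: gram_def scalar_prod_def u_def atLeast0LessThan intro!: sum.cong)
    finally show ?thesis using v(3) i by simp
  qed
  have "g u u = (\<Sum>j<n. u j * g u (coord_vec j))"
    using covector_expand[OF covector_inner_product[OF u] u] u by (simp add: coord_vec_in_Rn)
  also have "\<dots> = 0"
    using z u by (intro sum.neutral) (simp add: inner_product_commute[of u] coord_vec_in_Rn)
  finally have "u = (\<lambda>_. 0)" using inner_product_pos[OF u] by force
  then have "v = 0\<^sub>v n" using v(1) by (intro eq_vecI) (auto simp: u_def fun_eq_iff split: if_splits)
  with v(2) show False by simp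
qed

end

text \<open>Inner products form a convex set: on the segment h from the standard inner product to g the
  Gram determinant has no zero, and at the standard inner product it is 1. By the intermediate value
  theorem it stays positive.\<close>

lemma det_gram_pos:
  assumes g: "inner_product_on n g"
  shows "det (gram n g) > 0"
proof (rule ccontr)
  assume "\<not> 0 < det (gram n g)"
  define h where "h t u v = (1 - t) * (\<Sum>i<n. u i * v i) + t * g u v" for t u v
  have pos: "(\<Sum>i<n. u i * u i) > 0" if u: "u \<in> Rn n" "u \<noteq> (\<lambda>_. 0)" for u :: "nat \<Rightarrow> real"
  proof -
    obtain i where "u i \<noteq> 0" using u(2) by auto
    then have "i < n" using u(1) by (simp add: Rn_iff) (metis not_le)
    then show ?thesis using \<open>u i \<noteq> 0\<close> by (intro sum_pos2[of _ i]) (auto simp: zero_less_mult_iff neq_iff)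
  qed
  have h: "inner_product_on n (h t)" if t: "0 \<le> t" "t \<le> 1" for t
    unfolding inner_product_on_def
  proof (intro conjI ballI allI impI)
    fix u v w :: "nat \<Rightarrow> real" and a b
    assume "u \<in> Rn n" "v \<in> Rn n"
    then show "h t u v = h t v u" using inner_product_commute[OF g] by (simp add: h_def mult.commute)
    assume "w \<in> Rn n"
    with \<open>u \<in> Rn n\<close> \<open>v \<in> Rn n\<close> show "h t (\<lambda>i. a * u i + b * v i) w = a * h t u w + b * h t v w"
      by (simp add: h_def inner_product_linear_left[OF g] algebra_simps sum.distrib sum_distrib_left)
  next
    fix u :: "nat \<Rightarrow> real"
    assume u: "u \<in> Rn n" "u \<noteq> (\<lambda>_. 0)"
    note pos[OF u] inner_product_pos[OF g u]
    then show "h t u u > 0"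
      using t by (cases "t = 0") (auto simp: h_def intro!: add_nonneg_pos mult_nonneg_nonneg mult_pos_pos)
  qed
  let ?d = "\<lambda>t. det (gram n (h t))"
  have d: "?d t = (\<Sum>\<pi> | \<pi> permutes {0..<n}. signof \<pi> * (\<Prod>i = 0..<n. h t (coord_vec i) (coord_vec (\<pi> i))))" for t
    by (subst det_def'[OF gram_carrier]) (auto simp: gram_def intro!: sum.cong prod.cong dest: permutes_in_image)
  have "continuous_on {0..1} ?d"
    unfolding d h_def by (intro continuous_intros)
  moreover have "?d 1 = det (gram n g)" by (simp add: h_def gram_def)
  moreover have "?d 0 = 1"
  proof -
    have "(\<Sum>k<n. coord_vec i k * coord_vec j k) = (if i = j then 1 else 0)" if "i < n" "j < n" for i j
    proof -
      have "(\<Sum>k<n. coord_vec i k * coord_vec j k) = (\<Sum>k<n. if k = i then (if i = j then 1 else 0) else 0)"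
        by (intro sum.cong) (auto simp: coord_vec_def)
      then show ?thesis using that by simp
    qed
    then have "gram n (h 0) = 1\<^sub>m n" by (intro eq_matI) (auto simp: gram_def h_def)
    then show ?thesis by (simp add: det_one)
  qed
  ultimately obtain t where "0 \<le> t" "t \<le> 1" "?d t = 0"
    using IVT2'[of ?d 1 0 0] \<open>\<not> 0 < det (gram n g)\<close> by auto
  with det_gram_nonzero[OF h] show False by blast
qed

section \<open>The Hodge star of an oriented inner product space\<close>

lemma scaleR_Suc_divide_fact_Suc:
  fixes x :: "'b::real_vector"
  shows "(1 / fact (Suc p)) *\<^sub>R real (Suc p) *\<^sub>R x = (1 / fact p) *\<^sub>R x"
  unfolding scaleR_scaleR by (simp add: fact_Suc divide_simps del: of_nat_Suc)

lemma sum_lessThan_add: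
  fixes t :: "nat \<Rightarrow> 'b::comm_monoid_add"
  shows "(\<Sum>k<m + l. t k) = (\<Sum>k<m. t k) + (\<Sum>k<l. t (m + k))"
  by (induction l) (simp_all add: add.assoc)

locale oriented_inner_product =
  fixes n :: nat and g :: "(nat \<Rightarrow> real) \<Rightarrow> (nat \<Rightarrow> real) \<Rightarrow> real" and s :: real
  assumes inner: "inner_product_on n g" and s: "s \<in> {1, -1}"
begin

definition raise :: "((nat \<Rightarrow> real) \<Rightarrow> real) \<Rightarrow> nat \<Rightarrow> real" where
  "raise a = (THE v. v \<in> Rn n \<and> (\<forall>w\<in>Rn n. g v w = a w))"

text \<open>The vector dual to the j-th coordinate function, \<open>(dx\<^sup>j)\<^sup>\<sharp>\<close>.\<close>

definition dual :: "nat \<Rightarrow> nat \<Rightarrow> real" where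
  "dual j = raise (\<lambda>w. w j)"

definition flat :: "(nat \<Rightarrow> real) \<Rightarrow> (nat \<Rightarrow> real) \<Rightarrow> real" where
  "flat X = (\<lambda>w. if w \<in> Rn n then g X w else 0)"

lemma covector_flat: "X \<in> Rn n \<Longrightarrow> covector n (flat X)"
  unfolding flat_def by (rule covector_inner_product[OF inner])

lemma inner_product_cancel:
  assumes "u \<in> Rn n" "v \<in> Rn n" and eq: "\<And>w. w \<in> Rn n \<Longrightarrow> g u w = g v w"
  shows "u = v"
proof (rule ccontr)
  assume "u \<noteq> v"
  let ?d = "\<lambda>i. 1 * u i + (-1) * v i"
  have d: "?d \<in> Rn n" using assms(1,2) by (rule Rn_combination)
  have "g ?d ?d = 1 * g u ?d + (-1) * g v ?d"
    by (rule inner_product_linear_left[OF inner assms(1,2) d])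
  also have "\<dots> = 0" using eq[OF d] by simp
  finally have "g ?d ?d = 0" .
  moreover have "?d \<noteq> (\<lambda>_. 0)" using \<open>u \<noteq> v\<close> by (auto simp: fun_eq_iff)
  ultimately show False using inner_product_pos[OF inner d] by simp
qed

lemma raise_eqI:
  assumes "v \<in> Rn n" "\<And>w. w \<in> Rn n \<Longrightarrow> g v w = a w"
  shows "raise a = v"
  unfolding raise_def
proof (rule the_equality)
  show "u = v" if "u \<in> Rn n \<and> (\<forall>w\<in>Rn n. g u w = a w)" for u
    using that assms by (intro inner_product_cancel) auto
qed (use assms in blast)

text \<open>Cramer's rule. Besides giving existence of \<open>dual j\<close>, the formula shows that it depends smoothly
  on g.\<close>

lemma dual_adjugate:
  assumes j: "j < n"
  shows "dual j = (\<lambda>i. if i < n then inverse (det (gram n g)) * adj_mat (gram n g) $$ (i, j) else 0)" (is "_ = ?v")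
    and "w \<in> Rn n \<Longrightarrow> g (dual j) w = w j"
proof -
  let ?G = "gram n g"
  have v: "?v \<in> Rn n" by (simp add: Rn_iff)
  have vk: "g ?v (coord_vec k) = (if k = j then 1 else 0)" if k: "k < n" for k
  proof -
    have "g ?v (coord_vec k) = flat (coord_vec k) ?v"
      using v inner_product_commute[OF inner] by (simp add: flat_def coord_vec_in_Rn[OF k])
    also have "\<dots> = (\<Sum>i<n. ?v i * flat (coord_vec k) (coord_vec i))"
      by (rule covector_expand[OF covector_flat[OF coord_vec_in_Rn[OF k]] v])
    also have "\<dots> = inverse (det ?G) * (\<Sum>i<n. ?G $$ (k, i) * adj_mat ?G $$ (i, j))"
      unfolding sum_distrib_left using k by (intro sum.cong) (auto simp: flat_def gram_def coord_vec_in_Rn)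
    also have "(\<Sum>i<n. ?G $$ (k, i) * adj_mat ?G $$ (i, j)) = (?G * adj_mat ?G) $$ (k, j)"
      using adj_mat(1)[OF gram_carrier[of n g]] gram_carrier[of n g] k j
      by (auto simp: scalar_prod_def atLeast0LessThan)
    also have "\<dots> = (if k = j then det ?G else 0)"
      using adj_mat(2)[OF gram_carrier[of n g]] k j by simp
    finally show ?thesis using det_gram_nonzero[OF inner] by simp
  qed
  have vw: "g ?v w = w j" if w: "w \<in> Rn n" for w
  proof -
    have "g ?v w = (\<Sum>k<n. w k * flat ?v (coord_vec k))"
      using covector_expand[OF covector_flat[OF v] w] w by (simp add: flat_def)
    also have "\<dots> = (\<Sum>k<n. if k = j then w j else 0)"
      using v vk by (intro sum.cong) (auto simp: flat_def coord_vec_in_Rn)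
    finally show ?thesis using j by simp
  qed
  show eq: "dual j = ?v"
    unfolding dual_def by (rule raise_eqI[OF v vw])
  show "g (dual j) w = w j" if "w \<in> Rn n"
    unfolding eq by (rule vw[OF that])
qed

lemma dual_in_Rn: "j < n \<Longrightarrow> dual j \<in> Rn n"
  by (simp add: dual_adjugate(1) Rn_iff)

lemma raise_expand:
  assumes a: "covector n a"
  shows "raise a = (\<lambda>i. \<Sum>j<n. a (coord_vec j) * dual j i)"
proof (rule raise_eqI)
  show "(\<lambda>i. \<Sum>j<n. a (coord_vec j) * dual j i) \<in> Rn n"
    by (rule Rn_sum) (simp add: dual_in_Rn)
  fix w assume w: "w \<in> Rn n"
  have "g (\<lambda>i. \<Sum>j<n. a (coord_vec j) * dual j i) w = (\<Sum>j<n. a (coord_vec j) * g (dual j) w)"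
    by (rule inner_product_sum_left[OF inner w]) (simp add: dual_in_Rn)
  also have "\<dots> = a w"
    unfolding covector_expand[OF a w] using w by (intro sum.cong) (auto simp: dual_adjugate(2))
  finally show "g (\<lambda>i. \<Sum>j<n. a (coord_vec j) * dual j i) w = a w" .
qed

lemma raise_in_Rn: "covector n a \<Longrightarrow> raise a \<in> Rn n"
  unfolding raise_expand by (rule Rn_sum) (simp add: dual_in_Rn)

lemma inner_product_raise:
  assumes a: "covector n a" and w: "w \<in> Rn n"
  shows "g (raise a) w = a w"
proof -
  have "g (raise a) w = (\<Sum>j<n. a (coord_vec j) * g (dual j) w)"
    unfolding raise_expand[OF a] by (rule inner_product_sum_left[OF inner w]) (simp add: dual_in_Rn)
  also have "\<dots> = a w"
    unfolding covector_expand[OF a w] using w by (intro sum.cong) (auto simp: dual_adjugate(2))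
  finally show ?thesis .
qed

lemma raise_flat: "X \<in> Rn n \<Longrightarrow> raise (flat X) = X"
  by (rule raise_eqI) (simp_all add: flat_def)

lemma flat_dual: "j < n \<Longrightarrow> flat (dual j) = (\<lambda>w. if w \<in> Rn n then w j else 0)"
  by (auto simp: flat_def dual_adjugate(2))

text \<open>Together with \<open>vector_expand_dual\<close> this performs the contractions over a repeated index in the
  formula for the star: \<open>\<Sum>\<^sub>i a((dx\<^sup>i)\<^sup>\<sharp>) \<partial>\<^sub>i = a\<^sup>\<sharp>\<close> and
  \<open>\<Sum>\<^sub>i g(X, \<partial>\<^sub>i) (dx\<^sup>i)\<^sup>\<sharp> = X\<close>.\<close>

lemma raise_coordinates:
  assumes a: "covector n a"
  shows "raise a = (\<lambda>k. \<Sum>i<n. a (dual i) * coord_vec i k)"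
proof -
  have "raise a i = a (dual i)" if "i < n" for i
  proof -
    have "raise a i = g (dual i) (raise a)"
      by (simp add: dual_adjugate(2) that raise_in_Rn[OF a])
    also have "\<dots> = a (dual i)"
      using inner_product_commute[OF inner dual_in_Rn[OF that] raise_in_Rn[OF a]]
        inner_product_raise[OF a dual_in_Rn[OF that]] by simp
    finally show ?thesis .
  qed
  note component = this
  have "raise a = (\<lambda>k. \<Sum>i<n. raise a i * coord_vec i k)"
    by (rule Rn_expand[OF raise_in_Rn[OF a]])
  also have "\<dots> = (\<lambda>k. \<Sum>i<n. a (dual i) * coord_vec i k)"
    by (simp add: component)
  finally show ?thesis .
qed

lemma vector_expand_dual:
  assumes X: "X \<in> Rn n"
  shows "X = (\<lambda>k. \<Sum>i<n. flat X (coord_vec i) * dual i k)"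
  using raise_expand[OF covector_flat[OF X]] raise_flat[OF X] by simp

text \<open>The volume form, extended by zero to lists that do not consist of n vectors of \<open>Rn n\<close>, which
  makes it an alternating form.\<close>

definition vol :: "(nat \<Rightarrow> real) list \<Rightarrow> real" where
  "vol vs = (if length vs = n \<and> set vs \<subseteq> Rn n
     then s * sqrt (det (gram n g)) * det (columns_mat n vs) else 0)"

lemma alternating_vol: "alternating_form n n vol"
  unfolding alternating_form_def
proof (intro conjI allI impI)
  fix vs :: "(nat \<Rightarrow> real) list" and k u v and a b :: real
  assume vs: "length vs = n" "set vs \<subseteq> Rn n" and k: "k < n" and uv: "u \<in> Rn n" "v \<in> Rn n"
  have sub: "set (vs[k := x]) \<subseteq> Rn n" if "x \<in> Rn n" for x
    by (rule order_trans[OF set_update_subset_insert]) (simp only: insert_subset vs that simp_thms)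
  show "vol (vs[k := \<lambda>i. a * u i + b * v i]) = a *\<^sub>R vol (vs[k := u]) + b *\<^sub>R vol (vs[k := v])"
    using det_columns_mat_update[OF vs(1) k, of a u b v]
    by (simp add: vol_def vs(1) sub uv Rn_combination algebra_simps)
qed (auto simp: vol_def det_columns_mat_equal)

text \<open>The Hodge star at a point, in the index notation \<open>1/p! f\<^sup>I vol\<^sub>I\<^sub>J\<close>.\<close>

definition star :: "nat \<Rightarrow> ((nat \<Rightarrow> real) list \<Rightarrow> 'b::real_normed_vector) \<Rightarrow> (nat \<Rightarrow> real) list \<Rightarrow> 'b" where
  "star p f vs = (if set vs \<subseteq> Rn n \<and> p + length vs = n
     then (1 / fact p) *\<^sub>R (\<Sum>I\<in>multi_indices n p. vol (map coord_vec I @ vs) *\<^sub>R f (map dual I)) else 0)"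

lemma star_outside: "\<not> (set vs \<subseteq> Rn n \<and> p + length vs = n) \<Longrightarrow> star p f vs = 0"
  by (auto simp: star_def)

lemma star_sum: "star p (\<lambda>vs. \<Sum>k\<in>S. c k *\<^sub>R h k vs) vs = (\<Sum>k\<in>S. c k *\<^sub>R star p (h k) vs)"
proof (cases "set vs \<subseteq> Rn n \<and> p + length vs = n")
  case True
  then have "star p (\<lambda>vs. \<Sum>k\<in>S. c k *\<^sub>R h k vs) vs =
      (\<Sum>I\<in>multi_indices n p. \<Sum>k\<in>S. c k *\<^sub>R (1 / fact p) *\<^sub>R vol (map coord_vec I @ vs) *\<^sub>R h k (map dual I))"
    by (simp add: star_def scaleR_sum_right mult_ac)
  also have "\<dots> = (\<Sum>k\<in>S. \<Sum>I\<in>multi_indices n p. c k *\<^sub>R (1 / fact p) *\<^sub>R vol (map coord_vec I @ vs) *\<^sub>R h k (map dual I))"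
    by (rule sum.swap)
  finally show ?thesis using True by (simp add: star_def scaleR_sum_right)
qed (simp add: star_outside)

lemma star_scaleR: "star p (\<lambda>vs. c *\<^sub>R h vs) vs = c *\<^sub>R star p h vs"
  using star_sum[of p "\<lambda>_. c" "\<lambda>_. h" "{()}" vs] by simp

lemma set_multi_index_vectors:
  "I \<in> multi_indices n p \<Longrightarrow> set (map coord_vec I) \<subseteq> Rn n"
  "I \<in> multi_indices n p \<Longrightarrow> set (map dual I) \<subseteq> Rn n"
  by (auto simp: multi_indices_def coord_vec_in_Rn dual_in_Rn)

lemma alternating_star:
  assumes "p + q = n"
  shows "alternating_form n q (star p f)"
  unfolding alternating_form_def
proof (intro conjI allI impI)
  fix vs :: "(nat \<Rightarrow> real) list" and k u v and a b :: real
  assume vs: "length vs = q" "set vs \<subseteq> Rn n" and k: "k < q" and uv: "u \<in> Rn n" "v \<in> Rn n"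
  have sub: "set (vs[k := x]) \<subseteq> Rn n" if "x \<in> Rn n" for x
    by (rule order_trans[OF set_update_subset_insert]) (simp only: insert_subset vs that simp_thms)
  have "vol (map coord_vec I @ vs[k := \<lambda>i. a * u i + b * v i]) =
      a * vol (map coord_vec I @ vs[k := u]) + b * vol (map coord_vec I @ vs[k := v])" for I
    using alternating_form_linear[OF alternating_vol uv, of "map coord_vec I @ take k vs" a b "drop (Suc k) vs"] k vs
    by (simp add: upd_conv_take_nth_drop)
  then show "star p f (vs[k := \<lambda>i. a * u i + b * v i]) = a *\<^sub>R star p f (vs[k := u]) + b *\<^sub>R star p f (vs[k := v])"
    using assms by (simp add: star_def vs(1) sub uv Rn_combination scaleR_sum_right sum.distrib algebra_simps)
next
  fix vs :: "(nat \<Rightarrow> real) list" and j k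
  assume vs: "length vs = q" and jk: "j < k" "k < q" "vs ! j = vs ! k"
  have "vol (map coord_vec I @ vs) = 0" if "I \<in> multi_indices n p" for I
    using that vs jk assms
    by (intro alternating_form_equal_entries[OF alternating_vol, of _ "p + j" "p + k"])
      (auto simp: multi_indices_def nth_append)
  then show "star p f vs = 0" by (simp add: star_def)
qed (use assms in \<open>auto simp: star_def\<close>)

text \<open>Insert the alternation that defines \<open>a \<and> f\<close> into the sum over multi-indices of length p + 1. The
  k-th term moves the index \<open>I\<^sub>k\<close> to the front of the volume form, with the same sign \<open>(-1)\<^sup>k\<close>, so all
  p + 1 terms agree. The contraction over this index replaces it by \<open>a\<^sup>\<sharp>\<close>, and the sign \<open>(-1)\<^sup>p\<close> comes
  from moving \<open>a\<^sup>\<sharp>\<close> behind the other p indices.\<close>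

lemma star_wedge:
  fixes f :: "(nat \<Rightarrow> real) list \<Rightarrow> 'b::real_normed_vector"
  assumes a: "covector n a" and f: "alternating_form n p f"
  shows "star (Suc p) (covector_wedge a f) vs = (-1) ^ p *\<^sub>R star p f (raise a # vs)"
proof (cases "set vs \<subseteq> Rn n \<and> Suc p + length vs = n")
  case True
  let ?H = "\<lambda>i J. vol (coord_vec i # map coord_vec J @ vs) *\<^sub>R a (dual i) *\<^sub>R f (map dual J)"
  have expand: "vol (map coord_vec I @ vs) *\<^sub>R covector_wedge a f (map dual I) = (\<Sum>k<Suc p. ?H (I ! k) (remove_nth k I))"
    if I: "I \<in> multi_indices n (Suc p)" for I
  proof -
    have len: "length I = Suc p" using I by (simp add: multi_indices_def)
    have "vol (map coord_vec I @ vs) *\<^sub>R covector_wedge a f (map dual I) =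
        (\<Sum>k<Suc p. vol (map coord_vec I @ vs) *\<^sub>R (-1) ^ k *\<^sub>R a (dual (I ! k)) *\<^sub>R f (map dual (remove_nth k I)))"
      unfolding covector_wedge_def scaleR_sum_right length_map len
      by (intro sum.cong refl) (simp add: len map_remove_nth)
    also have "\<dots> = (\<Sum>k<Suc p. ?H (I ! k) (remove_nth k I))"
    proof (intro sum.cong refl)
      fix k assume "k \<in> {..<Suc p}"
      then have "vol (map coord_vec I @ vs) = (-1) ^ k * vol (coord_vec (I ! k) # map coord_vec (remove_nth k I) @ vs)"
        using alternating_form_map_nth_to_front[OF alternating_vol, of k I coord_vec vs] len by simp
      moreover have "(-1::real) ^ k * (-1) ^ k = 1" by (simp flip: power_add)
      ultimately show "vol (map coord_vec I @ vs) *\<^sub>R (-1) ^ k *\<^sub>R a (dual (I ! k)) *\<^sub>R f (map dual (remove_nth k I)) =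
          ?H (I ! k) (remove_nth k I)"
        by (simp add: mult_ac)
    qed
    finally show ?thesis .
  qed
  have "(\<Sum>I\<in>multi_indices n (Suc p). vol (map coord_vec I @ vs) *\<^sub>R covector_wedge a f (map dual I)) =
      (\<Sum>I\<in>multi_indices n (Suc p). \<Sum>k<Suc p. ?H (I ! k) (remove_nth k I))"
    by (intro sum.cong refl expand)
  also have "\<dots> = (\<Sum>k<Suc p. \<Sum>I\<in>multi_indices n (Suc p). ?H (I ! k) (remove_nth k I))"
    by (rule sum.swap)
  also have "\<dots> = (\<Sum>k<Suc p. \<Sum>i<n. \<Sum>J\<in>multi_indices n p. ?H i J)"
    by (intro sum.cong refl sum_multi_indices_remove_nth[where H="?H"]) simp
  also have "\<dots> = real (Suc p) *\<^sub>R (\<Sum>J\<in>multi_indices n p. \<Sum>i<n. ?H i J)"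
    by (subst sum.swap) (simp add: sum_constant_scaleR)
  also have "(\<Sum>J\<in>multi_indices n p. \<Sum>i<n. ?H i J) =
      (\<Sum>J\<in>multi_indices n p. (-1) ^ p *\<^sub>R vol (map coord_vec J @ raise a # vs) *\<^sub>R f (map dual J))"
  proof (intro sum.cong refl)
    fix J assume J: "J \<in> multi_indices n p"
    have "vol (raise a # map coord_vec J @ vs) = (\<Sum>i<n. a (dual i) * vol (coord_vec i # map coord_vec J @ vs))"
      unfolding raise_coordinates[OF a]
      using alternating_form_sum[OF alternating_vol coord_vec_in_Rn, where S="{..<n}" and us="[]"
          and ws="map coord_vec J @ vs" and c="\<lambda>i. a (dual i)"]
      by simp
    moreover have "vol (map coord_vec J @ raise a # vs) = (-1) ^ p * vol (raise a # map coord_vec J @ vs)"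
      using alternating_form_move_to_front[OF alternating_vol, of "map coord_vec J" "raise a" vs] J
      by (simp add: multi_indices_def)
    moreover have "(-1::real) ^ p * (-1) ^ p = 1" by (simp flip: power_add)
    ultimately show "(\<Sum>i<n. ?H i J) = (-1) ^ p *\<^sub>R vol (map coord_vec J @ raise a # vs) *\<^sub>R f (map dual J)"
      by (simp add: scaleR_sum_left mult_ac)
  qed
  finally have "(\<Sum>I\<in>multi_indices n (Suc p). vol (map coord_vec I @ vs) *\<^sub>R covector_wedge a f (map dual I)) =
      real (Suc p) *\<^sub>R (-1) ^ p *\<^sub>R (\<Sum>J\<in>multi_indices n p. vol (map coord_vec J @ raise a # vs) *\<^sub>R f (map dual J))"
    by (simp only: scaleR_sum_right)
  then have "star (Suc p) (covector_wedge a f) vs = (1 / fact (Suc p)) *\<^sub>R real (Suc p) *\<^sub>R (-1) ^ p *\<^sub>R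
      (\<Sum>J\<in>multi_indices n p. vol (map coord_vec J @ raise a # vs) *\<^sub>R f (map dual J))"
    using True by (simp only: star_def if_True simp_thms)
  then show ?thesis
    using True raise_in_Rn[OF a] unfolding scaleR_Suc_divide_fact_Suc by (simp add: star_def)
next
  case False
  then have "star p f (raise a # vs) = 0" by (intro star_outside) simp
  then show ?thesis by (simp only: star_outside[OF False] scaleR_zero_right)
qed

text \<open>Evaluate \<open>X\<^sup>\<flat> \<and> vol = 0\<close> on the coordinate vectors of a multi-index I of length p + 1
  followed by vs. The terms in which \<open>X\<^sup>\<flat>\<close> is applied to vs form the right-hand side of the claim;
  those in which it is applied to \<open>\<partial>\<^sub>I\<close> are p + 1 equal terms after summation over I, and the
  contraction over the index in \<open>X\<^sup>\<flat>\<close> inserts X into f.\<close>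

lemma star_interior:
  fixes f :: "(nat \<Rightarrow> real) list \<Rightarrow> 'b::real_normed_vector"
  assumes X: "X \<in> Rn n" and f: "alternating_form n (Suc p) f"
    and vs: "set vs \<subseteq> Rn n" "p + length vs = n"
  shows "star p (\<lambda>us. f (X # us)) vs = (-1) ^ p *\<^sub>R covector_wedge (flat X) (star (Suc p) f) vs"
proof -
  let ?b = "flat X"
  let ?H = "\<lambda>i J. (?b (coord_vec i) * vol (map coord_vec J @ vs)) *\<^sub>R f (dual i # map dual J)"
  have sgn: "(-1::real) ^ k * (-1) ^ k = 1" for k by (simp flip: power_add)
  have vanish: "(\<Sum>k<length vs. (-1) ^ k * (?b (vs ! k) * vol (map coord_vec I @ remove_nth k vs))) =
      (-1) ^ p * (\<Sum>k<Suc p. (-1) ^ k * (?b (coord_vec (I ! k)) * vol (map coord_vec (remove_nth k I) @ vs)))"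
    if I: "I \<in> multi_indices n (Suc p)" for I
  proof -
    have len: "length I = Suc p" using I by (simp add: multi_indices_def)
    let ?us = "map coord_vec I @ vs"
    let ?t = "\<lambda>k. (-1) ^ k * (?b (?us ! k) * vol (remove_nth k ?us))"
    have "0 = covector_wedge ?b vol ?us"
      using alternating_form_above_dimension[OF alternating_covector_wedge[OF covector_flat[OF X] alternating_vol]] by simp
    also have "\<dots> = (\<Sum>k<Suc p + length vs. ?t k)"
      by (simp add: covector_wedge_def len)
    also have "\<dots> = (\<Sum>k<Suc p. ?t k) + (\<Sum>k<length vs. ?t (Suc p + k))"
      by (rule sum_lessThan_add)
    also have "(\<Sum>k<Suc p. ?t k) =
        (\<Sum>k<Suc p. (-1) ^ k * (?b (coord_vec (I ! k)) * vol (map coord_vec (remove_nth k I) @ vs)))"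
      using len by (intro sum.cong refl) (auto simp: remove_nth_def nth_append take_map drop_map)
    also have "(\<Sum>k<length vs. ?t (Suc p + k)) =
        - ((-1) ^ p * (\<Sum>k<length vs. (-1) ^ k * (?b (vs ! k) * vol (map coord_vec I @ remove_nth k vs))))"
      unfolding sum_distrib_left sum_negf[symmetric] using len
      by (intro sum.cong refl) (auto simp: remove_nth_def nth_append power_add)
    finally have "(\<Sum>k<Suc p. (-1) ^ k * (?b (coord_vec (I ! k)) * vol (map coord_vec (remove_nth k I) @ vs))) =
        (-1) ^ p * (\<Sum>k<length vs. (-1) ^ k * (?b (vs ! k) * vol (map coord_vec I @ remove_nth k vs)))"
      by simp
    then show ?thesis by (simp add: mult.assoc[symmetric] sgn)
  qed
  have len: "Suc p + (length vs - 1) = n" if "k < length vs" for k using vs(2) that by simp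
  have "covector_wedge ?b (star (Suc p) f) vs =
      (\<Sum>k<length vs. \<Sum>I\<in>multi_indices n (Suc p). (1 / fact (Suc p)) *\<^sub>R
        ((-1) ^ k * (?b (vs ! k) * vol (map coord_vec I @ remove_nth k vs))) *\<^sub>R f (map dual I))"
    unfolding covector_wedge_def
  proof (intro sum.cong refl)
    fix k assume "k \<in> {..<length vs}"
    then show "(-1) ^ k *\<^sub>R ?b (vs ! k) *\<^sub>R star (Suc p) f (remove_nth k vs) =
        (\<Sum>I\<in>multi_indices n (Suc p). (1 / fact (Suc p)) *\<^sub>R
        ((-1) ^ k * (?b (vs ! k) * vol (map coord_vec I @ remove_nth k vs))) *\<^sub>R f (map dual I))"
      using vs set_remove_nth[OF vs(1), of k]
      by (simp add: star_def length_remove_nth scaleR_sum_right mult_ac del: fact_Suc)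
  qed
  also have "\<dots> = (\<Sum>I\<in>multi_indices n (Suc p). (1 / fact (Suc p)) *\<^sub>R
        (\<Sum>k<length vs. (-1) ^ k * (?b (vs ! k) * vol (map coord_vec I @ remove_nth k vs))) *\<^sub>R f (map dual I))"
    by (subst sum.swap) (simp only: scaleR_sum_left scaleR_sum_right)
  also have "\<dots> = (\<Sum>I\<in>multi_indices n (Suc p). (1 / fact (Suc p)) *\<^sub>R
        (-1) ^ p *\<^sub>R (\<Sum>k<Suc p. ?H (I ! k) (remove_nth k I)))"
  proof (intro sum.cong refl)
    fix I assume I: "I \<in> multi_indices n (Suc p)"
    have len: "length I = Suc p" using I by (simp add: multi_indices_def)
    have reduce: "((-1) ^ k * (?b (coord_vec (I ! k)) * vol (map coord_vec (remove_nth k I) @ vs))) *\<^sub>R f (map dual I) =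
        ?H (I ! k) (remove_nth k I)" if "k < Suc p" for k
    proof -
      have "f (map dual I) = (-1) ^ k *\<^sub>R f (dual (I ! k) # map dual (remove_nth k I))"
        using alternating_form_map_nth_to_front[OF f, of k I dual "[]"] that len by simp
      then show ?thesis using sgn[of k] by (simp add: mult.assoc[symmetric])
    qed
    have S: "(\<Sum>k<Suc p. (-1) ^ k * (?b (coord_vec (I ! k)) * vol (map coord_vec (remove_nth k I) @ vs))) *\<^sub>R f (map dual I) =
        (\<Sum>k<Suc p. ?H (I ! k) (remove_nth k I))"
      unfolding scaleR_sum_left by (intro sum.cong refl reduce) simp
    show "(1 / fact (Suc p)) *\<^sub>R
        (\<Sum>k<length vs. (-1) ^ k * (?b (vs ! k) * vol (map coord_vec I @ remove_nth k vs))) *\<^sub>R f (map dual I) =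
        (1 / fact (Suc p)) *\<^sub>R (-1) ^ p *\<^sub>R (\<Sum>k<Suc p. ?H (I ! k) (remove_nth k I))"
      by (simp only: vanish[OF I] S[symmetric] scaleR_scaleR mult.assoc)
  qed
  also have "\<dots> = (1 / fact (Suc p)) *\<^sub>R (-1) ^ p *\<^sub>R
      (\<Sum>k<Suc p. \<Sum>I\<in>multi_indices n (Suc p). ?H (I ! k) (remove_nth k I))"
    by (subst sum.swap) (simp only: scaleR_sum_right)
  also have "(\<Sum>k<Suc p. \<Sum>I\<in>multi_indices n (Suc p). ?H (I ! k) (remove_nth k I)) =
      (\<Sum>k<Suc p. \<Sum>i<n. \<Sum>J\<in>multi_indices n p. ?H i J)"
    by (intro sum.cong refl sum_multi_indices_remove_nth[where H="?H"]) simp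
  also have "\<dots> = real (Suc p) *\<^sub>R (\<Sum>J\<in>multi_indices n p. \<Sum>i<n. ?H i J)"
    by (subst sum.swap) (simp add: sum_constant_scaleR)
  also have "(\<Sum>J\<in>multi_indices n p. \<Sum>i<n. ?H i J) =
      (\<Sum>J\<in>multi_indices n p. vol (map coord_vec J @ vs) *\<^sub>R f (X # map dual J))"
  proof (intro sum.cong refl)
    fix J assume J: "J \<in> multi_indices n p"
    have d: "dual j \<in> Rn n" if "j \<in> {..<n}" for j using that by (simp add: dual_in_Rn)
    have "f (X # map dual J) = (\<Sum>i<n. ?b (coord_vec i) *\<^sub>R f (dual i # map dual J))"
      using alternating_form_sum[where S="{..<n}" and w=dual and us="[]"
          and ws="map dual J" and c="\<lambda>i. ?b (coord_vec i)", OF f d] vector_expand_dual[OF X, symmetric]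
      by simp
    then show "(\<Sum>i<n. ?H i J) = vol (map coord_vec J @ vs) *\<^sub>R f (X # map dual J)"
      by (simp add: scaleR_sum_right mult_ac)
  qed
  finally have "covector_wedge ?b (star (Suc p) f) vs = (1 / fact (Suc p)) *\<^sub>R real (Suc p) *\<^sub>R (-1) ^ p *\<^sub>R
      (\<Sum>J\<in>multi_indices n p. vol (map coord_vec J @ vs) *\<^sub>R f (X # map dual J))"
    by (simp only: scaleR_left_commute)
  then show ?thesis
    using vs unfolding scaleR_Suc_divide_fact_Suc by (simp add: star_def sgn)
qed

text \<open>The matrix of the dual basis is the inverse of the Gram matrix.\<close>

lemma vol_dual:
  assumes I: "I \<in> multi_indices n n"
  shows "vol (map dual I) = inverse (det (gram n g)) * vol (map coord_vec I)"
proof -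
  let ?G = "gram n g"
  have len: "length I = n" using I by (simp add: multi_indices_def)
  have "?G * columns_mat n (map dual I) = columns_mat n (map coord_vec I)"
  proof (rule eq_matI)
    fix i j assume "i < dim_row (columns_mat n (map coord_vec I))" "j < dim_col (columns_mat n (map coord_vec I))"
    then have ij: "i < n" "j < n" by (simp_all add: columns_mat_def)
    then have Ij: "dual (I ! j) \<in> Rn n" using nth_multi_indices[OF I] by (simp add: dual_in_Rn)
    have "(?G * columns_mat n (map dual I)) $$ (i, j) = (\<Sum>k<n. dual (I ! j) k * flat (coord_vec i) (coord_vec k))"
      using ij len by (auto simp: gram_def columns_mat_def scalar_prod_def atLeast0LessThan flat_def coord_vec_in_Rn
          mult.commute intro!: sum.cong)
    also have "\<dots> = g (coord_vec i) (dual (I ! j))"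
      using covector_expand[OF covector_flat[OF coord_vec_in_Rn[OF ij(1)]] Ij] Ij by (simp add: flat_def)
    also have "\<dots> = coord_vec i (I ! j)"
      using inner_product_commute[OF inner coord_vec_in_Rn[OF ij(1)] Ij] nth_multi_indices[OF I ij(2)]
        dual_adjugate(2) coord_vec_in_Rn[OF ij(1)] by simp
    finally show "(?G * columns_mat n (map dual I)) $$ (i, j) = columns_mat n (map coord_vec I) $$ (i, j)"
      using ij len by (auto simp: columns_mat_def coord_vec_def)
  qed (simp_all add: columns_mat_def gram_def)
  then have "det ?G * det (columns_mat n (map dual I)) = det (columns_mat n (map coord_vec I))"
    using det_mult[OF gram_carrier[of n g] columns_mat_carrier] by metis
  then have "det (columns_mat n (map dual I)) = inverse (det ?G) * det (columns_mat n (map coord_vec I))"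
    using det_gram_nonzero[OF inner] by (simp add: field_simps)
  then show ?thesis
    using set_multi_index_vectors[OF I] len by (simp add: vol_def)
qed

text \<open>This sum is \<open>n! ** 1\<close>, the start of the induction for \<open>star_star\<close>. Each of the n!
  arrangements of the coordinate vectors contributes
  \<open>(sqrt (det g))\<^sup>2 / det g = 1\<close>.\<close>

lemma sum_vol_vol_dual:
  "(\<Sum>I\<in>multi_indices n n. vol (map coord_vec I) * vol (map dual I)) = fact n"
proof -
  have "vol (map coord_vec I) * vol (map dual I) = (if distinct I then 1 else 0)" if I: "I \<in> multi_indices n n" for I
  proof -
    have "vol (map coord_vec I) = s * sqrt (det (gram n g)) * det (columns_mat n (map coord_vec I))"
      using I set_multi_index_vectors(1)[OF I] by (simp add: vol_def multi_indices_def)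
    then have "vol (map coord_vec I) * vol (map dual I) =
        inverse (det (gram n g)) * (s\<^sup>2 * (sqrt (det (gram n g)))\<^sup>2 * (det (columns_mat n (map coord_vec I)))\<^sup>2)"
      unfolding vol_dual[OF I] by (simp add: power2_eq_square)
    also have "\<dots> = (det (columns_mat n (map coord_vec I)))\<^sup>2"
      using s det_gram_pos[OF inner] by auto
    finally show ?thesis using det_coordinate_columns_squared[OF I] by simp
  qed
  then have "(\<Sum>I\<in>multi_indices n n. vol (map coord_vec I) * vol (map dual I)) =
      (\<Sum>I\<in>multi_indices n n. if distinct I then 1 else 0)"
    by (intro sum.cong refl)
  also have "\<dots> = real (card {I \<in> multi_indices n n. distinct I})"
    by (simp add: sum.If_cases finite_multi_indices Int_def)
  also have "{I \<in> multi_indices n n. distinct I} = {I. length I = n \<and> distinct I \<and> set I \<subseteq> {..<n}}"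
    by (auto simp: multi_indices_def)
  also have "card \<dots> = fact n"
    using card_lists_distinct_length_eq[of "{..<n}" n] by (simp add: fact_prod atLeast0LessThan prod.nat_diff_reindex)
  finally show ?thesis by simp
qed

text \<open>Here \<open>flat (dual k)\<close> is \<open>dx\<^sup>k\<close>. The sum over k reassembles the argument that is taken out in
  the j-th term of the alternation, and each of the p + 1 terms equals \<open>f vs\<close>. So f is a
  combination of exterior products of covectors with forms of lower degree.\<close>

lemma sum_coordinate_wedge_interior:
  fixes f :: "(nat \<Rightarrow> real) list \<Rightarrow> 'b::real_normed_vector"
  assumes f: "alternating_form n (Suc p) f" and vs: "set vs \<subseteq> Rn n" "length vs = Suc p"
  shows "(\<Sum>k<n. covector_wedge (flat (dual k)) (\<lambda>us. f (coord_vec k # us)) vs) = real (Suc p) *\<^sub>R f vs"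
proof -
  have "(\<Sum>k<n. covector_wedge (flat (dual k)) (\<lambda>us. f (coord_vec k # us)) vs) =
      (\<Sum>j<Suc p. (-1) ^ j *\<^sub>R (\<Sum>k<n. (vs ! j) k *\<^sub>R f (coord_vec k # remove_nth j vs)))"
    unfolding covector_wedge_def scaleR_sum_right vs(2)
  proof (subst sum.swap, intro sum.cong refl)
    fix j k assume "j \<in> {..<Suc p}" "k \<in> {..<n}"
    moreover from this have "vs ! j \<in> Rn n" using subsetD[OF vs(1) nth_mem] vs(2) by simp
    ultimately show "(-1) ^ j *\<^sub>R flat (dual k) (vs ! j) *\<^sub>R f (coord_vec k # remove_nth j vs) =
        (-1) ^ j *\<^sub>R (vs ! j) k *\<^sub>R f (coord_vec k # remove_nth j vs)"
      by (simp add: flat_dual)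
  qed
  also have "\<dots> = (\<Sum>j<Suc p. f vs)"
  proof (intro sum.cong refl)
    fix j assume j: "j \<in> {..<Suc p}"
    then have "vs ! j \<in> Rn n" using subsetD[OF vs(1) nth_mem] vs(2) by simp
    then have "(\<Sum>k<n. (vs ! j) k *\<^sub>R f (coord_vec k # remove_nth j vs)) = f (vs ! j # remove_nth j vs)"
      using alternating_form_expand[OF f, of "vs ! j" "[]" "remove_nth j vs"] by simp
    then show "(-1) ^ j *\<^sub>R (\<Sum>k<n. (vs ! j) k *\<^sub>R f (coord_vec k # remove_nth j vs)) = f vs"
      using alternating_form_nth_to_front[OF f, of j vs] j vs(2) by simp
  qed
  finally show ?thesis by (simp add: sum_constant_scaleR)
qed

lemma star_cong:
  assumes "\<And>us. set us \<subseteq> Rn n \<Longrightarrow> length us = p \<Longrightarrow> f us = h us"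
  shows "star p f vs = star p h vs"
proof -
  have "f (map dual I) = h (map dual I)" if "I \<in> multi_indices n p" for I
    using assms[of "map dual I"] set_multi_index_vectors(2)[OF that] that by (simp add: multi_indices_def)
  then show ?thesis by (simp add: star_def cong: sum.cong)
qed

text \<open>Induction on the degree. For a product \<open>a \<and> f\<close> of degree p + 1, \<open>star_wedge\<close> and then
  \<open>star_interior\<close> give \<open>**(a \<and> f) = (-1)\<^sup>p (-1)\<^sup>n\<^sup>-\<^sup>p\<^sup>-\<^sup>1 a \<and> **f\<close>, and
  \<open>sum_coordinate_wedge_interior\<close> reduces the general form to such products.\<close>

lemma star_star:
  fixes f :: "(nat \<Rightarrow> real) list \<Rightarrow> 'b::real_normed_vector"
  assumes "alternating_form n p f" "p \<le> n"
  shows "star (n - p) (star p f) vs = (-1) ^ (p * (n - p)) *\<^sub>R f vs"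
  using assms
proof (induction p arbitrary: f vs)
  case 0
  show ?case
  proof (cases "vs = []")
    case True
    have "star 0 f (map dual I) = vol (map dual I) *\<^sub>R f []" if "I \<in> multi_indices n n" for I
    proof -
      have "length I = n" "multi_indices n 0 = {[]}" using that by (auto simp: multi_indices_def)
      then show ?thesis using set_multi_index_vectors(2)[OF that] by (simp add: star_def)
    qed
    then have "star n (star 0 f) [] =
        (1 / fact n) *\<^sub>R (\<Sum>I\<in>multi_indices n n. vol (map coord_vec I) * vol (map dual I)) *\<^sub>R f []"
      by (simp add: star_def scaleR_sum_left cong: sum.cong)
    with True show ?thesis by (simp add: sum_vol_vol_dual)
  next
    case False
    then show ?thesis using alternating_form_outside[OF 0(1), of vs] by (simp add: star_def)
  qed
next
  case (Suc p)
  note f = Suc.prems(1)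
  show ?case
  proof (cases "set vs \<subseteq> Rn n \<and> length vs = Suc p")
    case True
    then have vs: "set vs \<subseteq> Rn n" "length vs = Suc p" by simp_all
    let ?q = "n - Suc p"
    have q: "n - p = Suc ?q" using Suc.prems(2) by simp
    let ?f = "\<lambda>k us. f (coord_vec k # us)"
    have fk: "alternating_form n p (?f k)" if "k < n" for k
      using that by (intro alternating_form_Cons[OF f] coord_vec_in_Rn)
    have step: "star ?q (star (Suc p) (covector_wedge (flat (dual k)) (?f k))) vs =
        (-1) ^ (Suc p * ?q) *\<^sub>R covector_wedge (flat (dual k)) (?f k) vs" if k: "k < n" for k
    proof -
      note d = dual_in_Rn[OF k]
      have "star (Suc p) (covector_wedge (flat (dual k)) (?f k)) = (\<lambda>us. (-1) ^ p *\<^sub>R star p (?f k) (dual k # us))"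
        by (rule ext) (simp only: star_wedge[OF covector_flat[OF d] fk[OF k]] raise_flat[OF d])
      then have "star ?q (star (Suc p) (covector_wedge (flat (dual k)) (?f k))) vs =
          (-1) ^ p *\<^sub>R star ?q (\<lambda>us. star p (?f k) (dual k # us)) vs"
        by (simp only: star_scaleR)
      also have "\<dots> = (-1) ^ p *\<^sub>R (-1) ^ ?q *\<^sub>R covector_wedge (flat (dual k)) (star (n - p) (star p (?f k))) vs"
      proof -
        have "alternating_form n (Suc ?q) (star p (?f k))"
          using Suc.prems(2) by (intro alternating_star) simp
        then show ?thesis
          using star_interior[OF d _ vs(1), of ?q "star p (?f k)"] vs(2) Suc.prems(2) by (simp add: q)
      qed
      also have "star (n - p) (star p (?f k)) = (\<lambda>us. (-1) ^ (p * (n - p)) *\<^sub>R ?f k us)"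
        using Suc.IH[OF fk[OF k]] Suc.prems(2) by auto
      also have "covector_wedge (flat (dual k)) (\<lambda>us. (-1) ^ (p * (n - p)) *\<^sub>R ?f k us) vs =
          (-1) ^ (p * (n - p)) *\<^sub>R covector_wedge (flat (dual k)) (?f k) vs"
        by (simp add: covector_wedge_def scaleR_sum_right mult_ac)
      also have "(-1) ^ p *\<^sub>R (-1) ^ ?q *\<^sub>R (-1) ^ (p * (n - p)) *\<^sub>R covector_wedge (flat (dual k)) (?f k) vs =
          (-1) ^ (p + ?q + p * (n - p)) *\<^sub>R covector_wedge (flat (dual k)) (?f k) vs"
        by (simp add: power_add mult_ac)
      also have "(-1::real) ^ (p + ?q + p * (n - p)) = (-1) ^ (Suc p * ?q)"
      proof -
        have "p + ?q + p * (n - p) = Suc p * ?q + 2 * p" unfolding q by simp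
        then show ?thesis by (simp only: power_add power_mult) simp
      qed
      finally show ?thesis .
    qed
    let ?c = "1 / real (Suc p)"
    have "f us = (\<Sum>k<n. ?c *\<^sub>R covector_wedge (flat (dual k)) (?f k) us)" if "set us \<subseteq> Rn n" "length us = Suc p" for us
      using sum_coordinate_wedge_interior[OF f that] by (simp flip: scaleR_sum_right)
    then have "star (Suc p) f = (\<lambda>us. \<Sum>k<n. ?c *\<^sub>R star (Suc p) (covector_wedge (flat (dual k)) (?f k)) us)"
      by (intro ext, subst star_cong[where h="\<lambda>us. \<Sum>k<n. ?c *\<^sub>R covector_wedge (flat (dual k)) (?f k) us"])
        (simp_all only: star_sum)
    then have "star ?q (star (Suc p) f) vs =
        (\<Sum>k<n. ?c *\<^sub>R star ?q (star (Suc p) (covector_wedge (flat (dual k)) (?f k))) vs)"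
      by (simp only: star_sum)
    also have "\<dots> = (-1) ^ (Suc p * ?q) *\<^sub>R ?c *\<^sub>R (\<Sum>k<n. covector_wedge (flat (dual k)) (?f k) vs)"
      unfolding scaleR_sum_right by (intro sum.cong refl) (simp only: step lessThan_iff scaleR_left_commute)
    also have "\<dots> = (-1) ^ (Suc p * ?q) *\<^sub>R f vs"
      by (simp add: sum_coordinate_wedge_interior[OF f vs])
    finally show ?thesis .
  next
    case False
    then have "f vs = 0" using alternating_form_outside[OF f] by blast
    moreover have "star (n - Suc p) (star (Suc p) f) vs = 0"
      using False Suc.prems(2) by (intro star_outside) auto
    ultimately show ?thesis by simp
  qed
qed

end

section \<open>Local differential forms\<close>

text \<open>A smooth form evaluated on smooth vector fields is smooth: expand one field after the other in
  the coordinate basis.\<close>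

lemma smooth_on_form_fields:
  assumes V: "openin (Euclidean_space n) V"
    and alt: "\<And>y. y \<in> V \<Longrightarrow> alternating_form n p (w y)"
    and w: "\<And>vs. set vs \<subseteq> Rn n \<Longrightarrow> smooth_on n V (\<lambda>y. w y vs)"
    and Fs: "\<And>F y. F \<in> set Fs \<Longrightarrow> y \<in> V \<Longrightarrow> F y \<in> Rn n"
      "\<And>F i. F \<in> set Fs \<Longrightarrow> i < n \<Longrightarrow> smooth_on n V (\<lambda>y. F y i)"
    and vs: "set vs \<subseteq> Rn n"
  shows "smooth_on n V (\<lambda>y. w y (map (\<lambda>F. F y) Fs @ vs))"
  using Fs vs
proof (induction Fs arbitrary: vs rule: rev_induct)
  case Nil
  then show ?case using w by simp
next
  case (snoc F Fs)
  have "smooth_on n V (\<lambda>y. w y (map (\<lambda>F. F y) Fs @ coord_vec i # vs))" if "i < n" for i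
    using snoc.prems that by (intro snoc.IH) (simp_all add: coord_vec_in_Rn)
  then have "smooth_on n V (\<lambda>y. \<Sum>i<n. F y i *\<^sub>R w y (map (\<lambda>F. F y) Fs @ coord_vec i # vs))"
    using snoc.prems(2) by (intro smooth_on_sum[OF V] smooth_on_scaleR[OF V]) simp_all
  moreover have "(\<Sum>i<n. F y i *\<^sub>R w y (map (\<lambda>F. F y) Fs @ coord_vec i # vs)) = w y (map (\<lambda>F. F y) (Fs @ [F]) @ vs)"
    if "y \<in> V" for y
    using alternating_form_expand[OF alt[OF that] snoc.prems(1)[OF _ that, of F], of "map (\<lambda>F. F y) Fs" vs] by simp
  ultimately show ?case by (rule smooth_on_cong[OF V, rotated])
qed

text \<open>Collections of smooth forms on the chart images, one chart at a time. Every operator of the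
  theory is defined in each chart separately and maps this class to itself, which is what allows the
  operators to be iterated.\<close>

definition local_forms :: "'a riemannian \<Rightarrow> nat \<Rightarrow> ('a, 'b::real_normed_vector) form set" where
  "local_forms M p = {\<omega>.
     (\<forall>c y. \<not> (c \<in> atlas M \<and> y \<in> chart_image c) \<longrightarrow> \<omega> c y = (\<lambda>_. 0)) \<and>
     (\<forall>c\<in>atlas M. \<forall>y\<in>chart_image c. alternating_form (mdim M) p (\<omega> c y)) \<and>
     (\<forall>c\<in>atlas M. \<forall>vs. set vs \<subseteq> Rn (mdim M) \<longrightarrow> smooth_on (mdim M) (chart_image c) (\<lambda>y. \<omega> c y vs))}"

lemma forms_subset_local_forms: "forms M p \<subseteq> local_forms M p"
  unfolding forms_def local_forms_def by (simp add: subset_iff)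

lemma local_formsD:
  assumes "\<omega> \<in> local_forms M p"
  shows "\<not> (c \<in> atlas M \<and> y \<in> chart_image c) \<Longrightarrow> \<omega> c y = (\<lambda>_. 0)"
    and "c \<in> atlas M \<Longrightarrow> y \<in> chart_image c \<Longrightarrow> alternating_form (mdim M) p (\<omega> c y)"
    and "c \<in> atlas M \<Longrightarrow> set vs \<subseteq> Rn (mdim M) \<Longrightarrow> smooth_on (mdim M) (chart_image c) (\<lambda>y. \<omega> c y vs)"
proof -
  note parts = assms[unfolded local_forms_def mem_Collect_eq]
  show "\<not> (c \<in> atlas M \<and> y \<in> chart_image c) \<Longrightarrow> \<omega> c y = (\<lambda>_. 0)"
    by (rule parts[THEN conjunct1, THEN spec, THEN spec, THEN mp])
  show "c \<in> atlas M \<Longrightarrow> y \<in> chart_image c \<Longrightarrow> alternating_form (mdim M) p (\<omega> c y)"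
    by (rule parts[THEN conjunct2, THEN conjunct1, THEN bspec, THEN bspec])
  show "c \<in> atlas M \<Longrightarrow> set vs \<subseteq> Rn (mdim M) \<Longrightarrow> smooth_on (mdim M) (chart_image c) (\<lambda>y. \<omega> c y vs)"
    by (rule parts[THEN conjunct2, THEN conjunct2, THEN bspec, THEN spec, THEN mp])
qed

lemma local_formsI:
  assumes "\<And>c y. \<not> (c \<in> atlas M \<and> y \<in> chart_image c) \<Longrightarrow> \<omega> c y = (\<lambda>_. 0)"
    and "\<And>c y. c \<in> atlas M \<Longrightarrow> y \<in> chart_image c \<Longrightarrow> alternating_form (mdim M) p (\<omega> c y)"
    and "\<And>c vs. c \<in> atlas M \<Longrightarrow> set vs \<subseteq> Rn (mdim M) \<Longrightarrow> smooth_on (mdim M) (chart_image c) (\<lambda>y. \<omega> c y vs)"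
  shows "\<omega> \<in> local_forms M p"
  unfolding local_forms_def mem_Collect_eq by (intro conjI allI ballI impI assms)

lemma local_form_outside:
  assumes "\<omega> \<in> local_forms M p" "\<not> (length vs = p \<and> set vs \<subseteq> Rn (mdim M))"
  shows "\<omega> c y vs = 0"
proof (cases "c \<in> atlas M \<and> y \<in> chart_image c")
  case True
  then show ?thesis using alternating_form_outside[OF local_formsD(2)[OF assms(1)] assms(2)] by simp
qed (simp add: local_formsD(1)[OF assms(1)])

lemma local_form_above_dimension:
  assumes "\<omega> \<in> local_forms M p" "mdim M < p"
  shows "\<omega> = (\<lambda>_ _ _. 0)"
proof (intro ext)
  show "\<omega> c y vs = 0" for c y vs
  proof (cases "c \<in> atlas M \<and> y \<in> chart_image c")
    case True
    then show ?thesis using alternating_form_above_dimension[OF local_formsD(2)[OF assms(1)] assms(2)] by simp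
  qed (simp add: local_formsD(1)[OF assms(1)])
qed

lemma local_form_update:
  assumes \<omega>: "\<omega> \<in> local_forms M p" and "length vs = p" "set vs \<subseteq> Rn (mdim M)" "k < p" "u \<in> Rn (mdim M)" "v \<in> Rn (mdim M)"
  shows "\<omega> c y (vs[k := (\<lambda>i. a * u i + b * v i)]) = a *\<^sub>R \<omega> c y (vs[k := u]) + b *\<^sub>R \<omega> c y (vs[k := v])"
proof (cases "c \<in> atlas M \<and> y \<in> chart_image c")
  case True
  then show ?thesis using alternating_form_update[OF local_formsD(2)[OF \<omega>] assms(2-)] by simp
qed (simp add: local_formsD(1)[OF \<omega>])

lemma local_form_equal_entries:
  assumes \<omega>: "\<omega> \<in> local_forms M p" and "length vs = p" "j < k" "k < p" "vs ! j = vs ! k"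
  shows "\<omega> c y vs = 0"
proof (cases "c \<in> atlas M \<and> y \<in> chart_image c")
  case True
  then show ?thesis
    by (intro alternating_form_equal_entries[OF local_formsD(2)[OF \<omega>] assms(2-)]) simp_all
qed (simp add: local_formsD(1)[OF \<omega>])

lemma alternating_form_add:
  assumes f: "alternating_form n p f" and h: "alternating_form n p h"
  shows "alternating_form n p (\<lambda>vs. f vs + h vs)"
  unfolding alternating_form_def
proof (intro conjI allI impI)
  fix vs :: "(nat \<Rightarrow> real) list" and k u v and a b :: real
  assume "length vs = p" "set vs \<subseteq> Rn n" "k < p" "u \<in> Rn n" "v \<in> Rn n"
  then show "f (vs[k := \<lambda>i. a * u i + b * v i]) + h (vs[k := \<lambda>i. a * u i + b * v i]) =
      a *\<^sub>R (f (vs[k := u]) + h (vs[k := u])) + b *\<^sub>R (f (vs[k := v]) + h (vs[k := v]))"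
    by (simp add: alternating_form_update[OF f] alternating_form_update[OF h] algebra_simps)
next
  fix vs :: "(nat \<Rightarrow> real) list" and j k
  assume "length vs = p" "j < k" "k < p" "vs ! j = vs ! k"
  then show "f vs + h vs = 0"
    by (simp only: alternating_form_equal_entries[OF f] alternating_form_equal_entries[OF h] add_0)
qed (simp only: alternating_form_outside[OF f] alternating_form_outside[OF h] add_0 simp_thms)

lemma alternating_form_cmult:
  fixes f :: "(nat \<Rightarrow> real) list \<Rightarrow> complex"
  assumes f: "alternating_form n p f"
  shows "alternating_form n p (\<lambda>vs. z * f vs)"
  unfolding alternating_form_def
proof (intro conjI allI impI)
  fix vs :: "(nat \<Rightarrow> real) list" and k u v and a b :: real
  assume "length vs = p" "set vs \<subseteq> Rn n" "k < p" "u \<in> Rn n" "v \<in> Rn n"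
  then show "z * f (vs[k := \<lambda>i. a * u i + b * v i]) = a *\<^sub>R (z * f (vs[k := u])) + b *\<^sub>R (z * f (vs[k := v]))"
    by (simp add: alternating_form_update[OF f] algebra_simps)
next
  fix vs :: "(nat \<Rightarrow> real) list" and j k
  assume "length vs = p" "j < k" "k < p" "vs ! j = vs ! k"
  then show "z * f vs = 0" by (simp only: alternating_form_equal_entries[OF f] mult_zero_right)
qed (simp only: alternating_form_outside[OF f] mult_zero_right simp_thms)

lemma wedge1_eq_covector_wedge: "wedge1 \<alpha> \<omega> c y = covector_wedge (\<lambda>v. \<alpha> c y [v]) (\<omega> c y)"
  by (rule ext) (simp add: wedge1_def covector_wedge_def)

lemma covector_of_form:
  assumes f: "alternating_form n 1 f"
  shows "covector n (\<lambda>v. f [v])"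
  unfolding covector_iff
proof (intro conjI allI ballI impI)
  show "f [v] = 0" if "v \<notin> Rn n" for v
    using alternating_form_outside[OF f, of "[v]"] that by simp
  show "f [\<lambda>i. a * u i + b * v i] = a * f [u] + b * f [v]" if "u \<in> Rn n" "v \<in> Rn n" for u v a b
    using alternating_form_linear[OF f that, of "[]" a b "[]"] by simp
qed

lemma hodge_scaleR: "hodge M p (\<lambda>c y vs. r *\<^sub>R \<omega> c y vs) = (\<lambda>c y vs. r *\<^sub>R hodge M p \<omega> c y vs)"
  by (intro ext) (simp add: hodge_def scaleR_sum_right mult_ac)

lemma hodge_add: "hodge M p (\<lambda>c y vs. \<omega> c y vs + \<eta> c y vs) = (\<lambda>c y vs. hodge M p \<omega> c y vs + hodge M p \<eta> c y vs)"
  by (intro ext) (simp add: hodge_def scaleR_add_right sum.distrib)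

lemma hodge_cmult: "hodge M p (\<lambda>c y vs. z * \<omega> c y vs) = (\<lambda>c y vs. z * hodge M p \<omega> c y vs)"
  for \<omega> :: "('a, complex) form"
  by (intro ext) (simp add: hodge_def sum_distrib_left)

lemma hodge_zero: "hodge M p (\<lambda>_ _ _. 0) = (\<lambda>_ _ _. 0)"
  by (intro ext) (simp add: hodge_def)

lemma hodge_above_dimension: "mdim M < p \<Longrightarrow> hodge M p \<omega> = (\<lambda>_ _ _. 0)"
  by (intro ext) (simp add: hodge_def)

text \<open>Inside a chart, at a point, the manifold is an oriented inner product space, and the star of
  forms is the star of that space (\<open>hodge_eq_star\<close>).\<close>

locale oriented_riemannian =
  fixes M :: "'a riemannian"
  assumes M: "oriented_riemannian_manifold M"
begin

abbreviation n :: nat where "n \<equiv> mdim M"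

lemma chart_image_open: "c \<in> atlas M \<Longrightarrow> openin (Euclidean_space n) (chart_image c)"
  using M by (simp add: oriented_riemannian_manifold_def smooth_manifold_def is_chart_def)

lemma oriented_inner_product_at:
  assumes "c \<in> atlas M" "y \<in> chart_image c"
  shows "oriented_inner_product n (metric M c y) (orient M c y)"
proof (rule oriented_inner_product.intro)
  have "\<forall>c\<in>atlas M. \<forall>y\<in>chart_image c. inner_product_on n (metric M c y)"
    using M unfolding oriented_riemannian_manifold_def by (elim conjE)
  from bspec[OF bspec[OF this assms(1)] assms(2)] show "inner_product_on n (metric M c y)" .
  have "\<forall>c\<in>atlas M. \<forall>y\<in>chart_image c. orient M c y \<in> {1, -1}"
    using M unfolding oriented_riemannian_manifold_def by (elim conjE)
  from bspec[OF bspec[OF this assms(1)] assms(2)] show "orient M c y \<in> {1, -1}" .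
qed

lemma smooth_metric:
  assumes "c \<in> atlas M" "u \<in> Rn n" "v \<in> Rn n"
  shows "smooth_on n (chart_image c) (\<lambda>y. metric M c y u v)"
proof -
  have "\<forall>c\<in>atlas M. \<forall>u\<in>Rn n. \<forall>v\<in>Rn n. smooth_on n (chart_image c) (\<lambda>y. metric M c y u v)"
    using M unfolding oriented_riemannian_manifold_def by (elim conjE)
  from bspec[OF bspec[OF bspec[OF this assms(1)] assms(2)] assms(3)] show ?thesis .
qed

lemma smooth_orient:
  assumes c: "c \<in> atlas M"
  shows "smooth_on n (chart_image c) (orient M c)"
proof (rule smooth_on_sign[OF chart_image_open[OF c]])
  have "\<forall>c\<in>atlas M. continuous_map (subtopology (Euclidean_space n) (chart_image c)) euclideanreal (orient M c)"
    using M unfolding oriented_riemannian_manifold_def by (elim conjE)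
  from bspec[OF this c] show "continuous_on (chart_image c) (orient M c)"
    by (simp only: continuous_map_Euclidean_subtopology_iff[OF openin_subset[OF chart_image_open[OF c]]])
  show "orient M c y \<in> {1, -1}" if "y \<in> chart_image c" for y
    by (rule oriented_inner_product.s[OF oriented_inner_product_at[OF c that]])
qed

abbreviation dual_at :: "'a chart \<Rightarrow> (nat \<Rightarrow> real) \<Rightarrow> nat \<Rightarrow> nat \<Rightarrow> real" where
  "dual_at c y \<equiv> oriented_inner_product.dual n (metric M c y)"

abbreviation vol_at :: "'a chart \<Rightarrow> (nat \<Rightarrow> real) \<Rightarrow> (nat \<Rightarrow> real) list \<Rightarrow> real" where
  "vol_at c y \<equiv> oriented_inner_product.vol n (metric M c y) (orient M c y)"

abbreviation star_at :: "'a chart \<Rightarrow> (nat \<Rightarrow> real) \<Rightarrow> nat \<Rightarrow> ((nat \<Rightarrow> real) list \<Rightarrow> 'b::real_normed_vector) \<Rightarrow> (nat \<Rightarrow> real) list \<Rightarrow> 'b" where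
  "star_at c y \<equiv> oriented_inner_product.star n (metric M c y) (orient M c y)"

lemma sharp_covector_eq_raise:
  assumes "c \<in> atlas M" "y \<in> chart_image c"
  shows "sharp_covector M c y = oriented_inner_product.raise n (metric M c y)"
  by (rule ext) (simp add: sharp_covector_def oriented_inner_product.raise_def[OF oriented_inner_product_at[OF assms]])

lemma hodge_eq_star:
  assumes cy: "c \<in> atlas M" "y \<in> chart_image c"
  shows "hodge M p \<omega> c y = star_at c y p (\<omega> c y)"
proof
  fix vs
  interpret pt: oriented_inner_product n "metric M c y" "orient M c y"
    by (rule oriented_inner_product_at[OF cy])
  show "hodge M p \<omega> c y vs = star_at c y p (\<omega> c y) vs"
  proof (cases "set vs \<subseteq> Rn n \<and> p + length vs = n")
    case True
    have v: "volume_form M c y (map coord_vec I @ vs) = pt.vol (map coord_vec I @ vs)" if I: "I \<in> multi_indices n p" for I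
    proof -
      have "length (map coord_vec I @ vs) = n" "set (map coord_vec I @ vs) \<subseteq> Rn n"
        using True pt.set_multi_index_vectors(1)[OF I] I by (simp_all add: multi_indices_def)
      then show ?thesis by (simp only: volume_form_def pt.vol_def gram_def columns_mat_def simp_thms if_True)
    qed
    show ?thesis
      using True cy unfolding hodge_def pt.star_def pt.dual_def sharp_covector_eq_raise[OF cy] multi_indices_def[symmetric]
      by (simp add: v cong: sum.cong)
  next
    case False
    have "hodge M p \<omega> c y vs = 0" unfolding hodge_def by (rule if_not_P) (use False in simp)
    then show ?thesis by (simp only: pt.star_outside[OF False])
  qed
qed

lemma hodge_outside_charts: "\<not> (c \<in> atlas M \<and> y \<in> chart_image c) \<Longrightarrow> hodge M p \<omega> c y = (\<lambda>_. 0)"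
  unfolding hodge_def by (intro ext if_not_P) auto

lemma smooth_det_gram:
  assumes c: "c \<in> atlas M"
  shows "smooth_on n (chart_image c) (\<lambda>y. det (gram n (metric M c y)))"
  unfolding gram_def
  by (rule smooth_on_det[OF chart_image_open[OF c]]) (simp add: smooth_metric[OF c] coord_vec_in_Rn)

text \<open>By Cramer's rule the components are cofactors of the Gram matrix divided by its
  determinant.\<close>

lemma smooth_dual:
  assumes c: "c \<in> atlas M" and j: "j < n" and i: "i < n"
  shows "smooth_on n (chart_image c) (\<lambda>y. dual_at c y j i)"
proof -
  note V = chart_image_open[OF c]
  let ?G = "\<lambda>y. gram n (metric M c y)"
  let ?r = "\<lambda>a. if a < j then a else Suc a" and ?s = "\<lambda>b. if b < i then b else Suc b"
  have "adj_mat (?G y) $$ (i, j) =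
      (-1) ^ (j + i) * det (mat (n - 1) (n - 1) (\<lambda>(a, b). metric M c y (coord_vec (?r a)) (coord_vec (?s b))))" for y
  proof -
    have "mat_delete (?G y) j i = mat (n - 1) (n - 1) (\<lambda>(a, b). metric M c y (coord_vec (?r a)) (coord_vec (?s b)))"
      by (rule eq_matI) (auto simp: mat_delete_def gram_def)
    then show ?thesis using i j by (simp add: adj_mat_def gram_def cofactor_def)
  qed
  moreover have "smooth_on n (chart_image c) (\<lambda>y. (-1) ^ (j + i) *
      det (mat (n - 1) (n - 1) (\<lambda>(a, b). metric M c y (coord_vec (?r a)) (coord_vec (?s b)))))"
    by (intro smooth_on_mult[OF V] smooth_on_const[OF V] smooth_on_det[OF V] smooth_metric[OF c] coord_vec_in_Rn) auto
  ultimately have adj: "smooth_on n (chart_image c) (\<lambda>y. adj_mat (?G y) $$ (i, j))" by simp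
  have "smooth_on n (chart_image c) (\<lambda>y. inverse (det (?G y)) * adj_mat (?G y) $$ (i, j))"
    using det_gram_nonzero[OF oriented_inner_product.inner[OF oriented_inner_product_at[OF c]]]
    by (intro smooth_on_mult[OF V] smooth_on_inverse[OF V] smooth_det_gram[OF c] adj)
  then show ?thesis
    by (rule smooth_on_cong[OF V, rotated])
      (simp add: oriented_inner_product.dual_adjugate(1)[OF oriented_inner_product_at[OF c] j] i)
qed

lemma smooth_vol:
  assumes c: "c \<in> atlas M"
  shows "smooth_on n (chart_image c) (\<lambda>y. vol_at c y vs)"
proof -
  note V = chart_image_open[OF c]
  have "smooth_on n (chart_image c) (\<lambda>y. orient M c y * sqrt (det (gram n (metric M c y))) *
      (if length vs = n \<and> set vs \<subseteq> Rn n then det (columns_mat n vs) else 0))"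
    using det_gram_pos[OF oriented_inner_product.inner[OF oriented_inner_product_at[OF c]]]
    by (intro smooth_on_mult[OF V] smooth_on_sqrt[OF V] smooth_det_gram[OF c] smooth_orient[OF c] smooth_on_const[OF V])
  then show ?thesis
    by (rule smooth_on_cong[OF V, rotated])
      (simp add: oriented_inner_product.vol_def[OF oriented_inner_product_at[OF c]])
qed

text \<open>The point enters the formula for the star in two places: in the volume form, and in the vectors
  \<open>(dx\<^sup>i)\<^sup>\<sharp>\<close> on which the form is evaluated.\<close>

lemma hodge_local_form:
  assumes \<omega>: "\<omega> \<in> local_forms M p" and pq: "p + q = n"
  shows "hodge M p \<omega> \<in> local_forms M q"
proof (rule local_formsI)
  show "hodge M p \<omega> c y = (\<lambda>_. 0)" if "\<not> (c \<in> atlas M \<and> y \<in> chart_image c)" for c y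
    by (rule hodge_outside_charts[OF that])
  show "alternating_form n q (hodge M p \<omega> c y)" if "c \<in> atlas M" "y \<in> chart_image c" for c y
    unfolding hodge_eq_star[OF that]
    by (rule oriented_inner_product.alternating_star[OF oriented_inner_product_at[OF that] pq])
  fix c vs assume c: "c \<in> atlas M" and vs: "set vs \<subseteq> Rn n"
  note V = chart_image_open[OF c]
  have fields: "smooth_on n (chart_image c) (\<lambda>y. \<omega> c y (map (dual_at c y) I))" if I: "I \<in> multi_indices n p" for I
  proof -
    have "smooth_on n (chart_image c) (\<lambda>y. \<omega> c y (map (\<lambda>F. F y) (map (\<lambda>i y. dual_at c y i) I) @ []))"
    proof (rule smooth_on_form_fields[OF V, where p=p])
      show "alternating_form n p (\<omega> c y)" if "y \<in> chart_image c" for y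
        by (rule local_formsD(2)[OF \<omega> c that])
      show "smooth_on n (chart_image c) (\<lambda>y. \<omega> c y vs)" if "set vs \<subseteq> Rn n" for vs
        by (rule local_formsD(3)[OF \<omega> c that])
      fix F assume "F \<in> set (map (\<lambda>i y. dual_at c y i) I)"
      then obtain j where j: "j < n" "F = (\<lambda>y. dual_at c y j)" using I by (auto simp: multi_indices_def)
      show "F y \<in> Rn n" if "y \<in> chart_image c" for y
        unfolding j(2) by (rule oriented_inner_product.dual_in_Rn[OF oriented_inner_product_at[OF c that] j(1)])
      show "smooth_on n (chart_image c) (\<lambda>y. F y i)" if "i < n" for i
        unfolding j(2) by (rule smooth_dual[OF c j(1) that])
    qed simp
    then show ?thesis by (simp only: map_map comp_def append_Nil2)
  qed
  have "smooth_on n (chart_image c) (\<lambda>y. (if p + length vs = n then 1 / fact p else 0) *\<^sub>R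
      (\<Sum>I\<in>multi_indices n p. vol_at c y (map coord_vec I @ vs) *\<^sub>R \<omega> c y (map (dual_at c y) I)))"
    by (intro smooth_on_scaleR[OF V] smooth_on_const[OF V] smooth_on_sum[OF V] smooth_vol[OF c] fields)
  then show "smooth_on n (chart_image c) (\<lambda>y. hodge M p \<omega> c y vs)"
    by (rule smooth_on_cong[OF V, rotated])
      (simp add: hodge_eq_star[OF c] oriented_inner_product.star_def[OF oriented_inner_product_at[OF c]] vs)
qed

lemma local_form_add:
  assumes \<omega>: "\<omega> \<in> local_forms M p" and \<eta>: "\<eta> \<in> local_forms M p"
  shows "(\<lambda>c y vs. \<omega> c y vs + \<eta> c y vs) \<in> local_forms M p"
proof (rule local_formsI)
  show "(\<lambda>vs. \<omega> c y vs + \<eta> c y vs) = (\<lambda>_. 0)" if "\<not> (c \<in> atlas M \<and> y \<in> chart_image c)" for c y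
    by (simp only: local_formsD(1)[OF \<omega> that] local_formsD(1)[OF \<eta> that] add_0)
qed (intro alternating_form_add smooth_on_add chart_image_open local_formsD(2,3)[OF \<omega>] local_formsD(2,3)[OF \<eta>]; assumption)+

lemma local_form_scaleR:
  assumes \<omega>: "\<omega> \<in> local_forms M p"
  shows "(\<lambda>c y vs. r *\<^sub>R \<omega> c y vs) \<in> local_forms M p"
proof (rule local_formsI)
  show "(\<lambda>vs. r *\<^sub>R \<omega> c y vs) = (\<lambda>_. 0)" if "\<not> (c \<in> atlas M \<and> y \<in> chart_image c)" for c y
    by (simp only: local_formsD(1)[OF \<omega> that] scaleR_zero_right)
qed (intro alternating_form_scaleR smooth_on_scaleR smooth_on_const chart_image_open local_formsD(2,3)[OF \<omega>]; assumption)+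

lemma local_form_cmult:
  fixes \<omega> :: "('a, complex) form"
  assumes \<omega>: "\<omega> \<in> local_forms M p"
  shows "(\<lambda>c y vs. z * \<omega> c y vs) \<in> local_forms M p"
proof (rule local_formsI)
  show "(\<lambda>vs. z * \<omega> c y vs) = (\<lambda>_. 0)" if "\<not> (c \<in> atlas M \<and> y \<in> chart_image c)" for c y
    by (simp only: local_formsD(1)[OF \<omega> that] mult_zero_right)
qed (intro alternating_form_cmult smooth_on_mult smooth_on_const chart_image_open local_formsD(2,3)[OF \<omega>]; assumption)+

lemma wedge1_local_form:
  fixes \<omega> :: "('a, 'b::real_normed_vector) form"
  assumes \<alpha>: "\<alpha> \<in> local_forms M 1" and \<omega>: "\<omega> \<in> local_forms M p"
  shows "wedge1 \<alpha> \<omega> \<in> local_forms M (Suc p)"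
proof (rule local_formsI)
  show "wedge1 \<alpha> \<omega> c y = (\<lambda>_. 0)" if "\<not> (c \<in> atlas M \<and> y \<in> chart_image c)" for c y
    by (rule ext) (simp add: wedge1_def local_formsD(1)[OF \<omega> that])
  show "alternating_form n (Suc p) (wedge1 \<alpha> \<omega> c y)" if "c \<in> atlas M" "y \<in> chart_image c" for c y
    unfolding wedge1_eq_covector_wedge
    by (rule alternating_covector_wedge[OF covector_of_form[OF local_formsD(2)[OF \<alpha> that]] local_formsD(2)[OF \<omega> that]])
  fix c vs assume c: "c \<in> atlas M" and vs: "set vs \<subseteq> Rn n"
  note V = chart_image_open[OF c]
  show "smooth_on n (chart_image c) (\<lambda>y. wedge1 \<alpha> \<omega> c y vs)"
    unfolding wedge1_def
  proof (intro smooth_on_sum[OF V] smooth_on_scaleR[OF V] smooth_on_const[OF V] local_formsD(3)[OF \<alpha> c] local_formsD(3)[OF \<omega> c])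
    fix k assume "k \<in> {..<length vs}"
    then show "set [vs ! k] \<subseteq> Rn n" using subsetD[OF vs nth_mem] by simp
  qed (rule set_remove_nth[OF vs])
qed

lemma sharp_in_Rn:
  assumes \<alpha>: "\<alpha> \<in> local_forms M 1" and cy: "c \<in> atlas M" "y \<in> chart_image c"
  shows "sharp M \<alpha> c y \<in> Rn n"
  unfolding sharp_def sharp_covector_eq_raise[OF cy]
  by (rule oriented_inner_product.raise_in_Rn[OF oriented_inner_product_at[OF cy] covector_of_form[OF local_formsD(2)[OF \<alpha> cy]]])

lemma smooth_sharp:
  assumes \<alpha>: "\<alpha> \<in> local_forms M 1" and c: "c \<in> atlas M" and i: "i < n"
  shows "smooth_on n (chart_image c) (\<lambda>y. sharp M \<alpha> c y i)"
proof -
  note V = chart_image_open[OF c]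
  have "smooth_on n (chart_image c) (\<lambda>y. \<Sum>j<n. \<alpha> c y [coord_vec j] * dual_at c y j i)"
    by (intro smooth_on_sum[OF V] smooth_on_mult[OF V] local_formsD(3)[OF \<alpha> c] smooth_dual[OF c])
      (simp_all add: coord_vec_in_Rn i)
  then show ?thesis
    by (rule smooth_on_cong[OF V, rotated])
      (simp add: sharp_def sharp_covector_eq_raise[OF c] oriented_inner_product.raise_expand[OF
        oriented_inner_product_at[OF c] covector_of_form[OF local_formsD(2)[OF \<alpha> c]]])
qed

lemma interior_sharp_local_form:
  assumes \<alpha>: "\<alpha> \<in> local_forms M 1" and \<omega>: "\<omega> \<in> local_forms M (Suc p)"
  shows "interior (sharp M \<alpha>) \<omega> \<in> local_forms M p"
proof (rule local_formsI)
  show "interior (sharp M \<alpha>) \<omega> c y = (\<lambda>_. 0)" if "\<not> (c \<in> atlas M \<and> y \<in> chart_image c)" for c y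
    by (simp only: interior_def local_formsD(1)[OF \<omega> that])
  show "alternating_form n p (interior (sharp M \<alpha>) \<omega> c y)" if "c \<in> atlas M" "y \<in> chart_image c" for c y
    unfolding interior_def
    by (rule alternating_form_Cons[OF local_formsD(2)[OF \<omega> that] sharp_in_Rn[OF \<alpha> that]])
  fix c vs assume c: "c \<in> atlas M" and vs: "set vs \<subseteq> Rn n"
  have "smooth_on n (chart_image c) (\<lambda>y. \<omega> c y (map (\<lambda>F. F y) [sharp M \<alpha> c] @ vs))"
    by (rule smooth_on_form_fields[OF chart_image_open[OF c] local_formsD(2)[OF \<omega> c] local_formsD(3)[OF \<omega> c] _ _ vs])
      (simp_all add: sharp_in_Rn[OF \<alpha> c] smooth_sharp[OF \<alpha> c])
  then show "smooth_on n (chart_image c) (\<lambda>y. interior (sharp M \<alpha>) \<omega> c y vs)"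
    by (simp add: interior_def)
qed

lemma interior_of_function: "\<omega> \<in> local_forms M 0 \<Longrightarrow> interior X \<omega> = (\<lambda>_ _ _. 0)"
  by (intro ext) (simp add: interior_def local_form_outside)

lemma partial_deriv_zero: "partial_deriv i (\<lambda>_. 0) y = 0"
  by (simp add: partial_deriv_def vector_derivative_const_at)

lemma ext_deriv_zero: "ext_deriv M (\<lambda>_ _ _. 0) = (\<lambda>_ _ _. 0)"
  by (intro ext) (simp add: ext_deriv_def partial_deriv_zero)

text \<open>A value of \<open>partial_deriv\<close> at a point without derivative is arbitrary, so even homogeneity needs
  a differentiable form.\<close>

lemma ext_deriv_scaleR:
  assumes \<omega>: "\<omega> \<in> local_forms M p"
  shows "ext_deriv M (\<lambda>c y vs. r *\<^sub>R \<omega> c y vs) = (\<lambda>c y vs. r *\<^sub>R ext_deriv M \<omega> c y vs)"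
proof (intro ext)
  fix c y vs
  show "ext_deriv M (\<lambda>c y vs. r *\<^sub>R \<omega> c y vs) c y vs = r *\<^sub>R ext_deriv M \<omega> c y vs"
  proof (cases "c \<in> atlas M \<and> y \<in> chart_image c \<and> set vs \<subseteq> Rn n")
    case True
    then have c: "c \<in> atlas M" and y: "y \<in> chart_image c" and vs: "set vs \<subseteq> Rn n" by simp_all
    have "partial_deriv i (\<lambda>z. r *\<^sub>R \<omega> c z (remove_nth k vs)) y = r *\<^sub>R partial_deriv i (\<lambda>z. \<omega> c z (remove_nth k vs)) y"
      if "i < n" for i k
      by (rule partial_deriv_linear[OF bounded_linear_scaleR_right local_formsD(3)[OF \<omega> c set_remove_nth[OF vs]] that y])
    note linear = this
    have "ext_deriv M (\<lambda>c y vs. r *\<^sub>R \<omega> c y vs) c y vs = (\<Sum>k<length vs. (-1) ^ k *\<^sub>R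
        (\<Sum>i<n. (vs ! k) i *\<^sub>R partial_deriv i (\<lambda>z. r *\<^sub>R \<omega> c z (remove_nth k vs)) y))"
      unfolding ext_deriv_def by (rule if_P) (rule True)
    also have "\<dots> = (\<Sum>k<length vs. (-1) ^ k *\<^sub>R
        (\<Sum>i<n. (vs ! k) i *\<^sub>R r *\<^sub>R partial_deriv i (\<lambda>z. \<omega> c z (remove_nth k vs)) y))"
      by (intro sum.cong refl arg_cong[where f="scaleR _"] linear) simp
    also have "\<dots> = r *\<^sub>R (\<Sum>k<length vs. (-1) ^ k *\<^sub>R
        (\<Sum>i<n. (vs ! k) i *\<^sub>R partial_deriv i (\<lambda>z. \<omega> c z (remove_nth k vs)) y))"
      by (simp only: scaleR_sum_right scaleR_left_commute[of r])
    also have "\<dots> = r *\<^sub>R ext_deriv M \<omega> c y vs"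
      using True by (simp only: ext_deriv_def if_True simp_thms)
    finally show ?thesis .
  qed (auto simp: ext_deriv_def)
qed

lemma ext_deriv_local_form:
  fixes \<omega> :: "('a, 'b::real_normed_vector) form"
  assumes \<omega>: "\<omega> \<in> local_forms M p"
  shows "ext_deriv M \<omega> \<in> local_forms M (Suc p)"
proof (rule local_formsI)
  show "ext_deriv M \<omega> c y = (\<lambda>_. 0)" if "\<not> (c \<in> atlas M \<and> y \<in> chart_image c)" for c y
    using that by (intro ext) (auto simp: ext_deriv_def)
next
  fix c y assume cy: "c \<in> atlas M" "y \<in> chart_image c"
  let ?F = "\<lambda>v ws. \<Sum>i<n. v i *\<^sub>R partial_deriv i (\<lambda>z. \<omega> c z ws) y"
  show "alternating_form n (Suc p) (ext_deriv M \<omega> c y)"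
  proof (rule alternating_form_alternation[where F="?F"])
    fix v :: "nat \<Rightarrow> real"
    show "alternating_form n p (?F v)"
      unfolding alternating_form_def
    proof (intro conjI allI impI)
      fix ws :: "(nat \<Rightarrow> real) list" and k u w and a b :: real
      assume ws: "length ws = p" "set ws \<subseteq> Rn n" and k: "k < p" and uw: "u \<in> Rn n" "w \<in> Rn n"
      have sub: "set (ws[k := x]) \<subseteq> Rn n" if "x \<in> Rn n" for x
        by (rule order_trans[OF set_update_subset_insert]) (simp only: insert_subset ws that simp_thms)
      have "partial_deriv i (\<lambda>z. \<omega> c z (ws[k := \<lambda>i. a * u i + b * w i])) y =
          a *\<^sub>R partial_deriv i (\<lambda>z. \<omega> c z (ws[k := u])) y + b *\<^sub>R partial_deriv i (\<lambda>z. \<omega> c z (ws[k := w])) y" if i: "i < n" for i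
      proof -
        note V = chart_image_open[OF cy(1)]
        note su = local_formsD(3)[OF \<omega> cy(1) sub[OF uw(1)]] and sw = local_formsD(3)[OF \<omega> cy(1) sub[OF uw(2)]]
        have "partial_deriv i (\<lambda>z. \<omega> c z (ws[k := \<lambda>i. a * u i + b * w i])) y =
            partial_deriv i (\<lambda>z. a *\<^sub>R \<omega> c z (ws[k := u]) + b *\<^sub>R \<omega> c z (ws[k := w])) y"
          by (simp only: local_form_update[OF \<omega> ws k uw])
        also have "\<dots> = partial_deriv i (\<lambda>z. a *\<^sub>R \<omega> c z (ws[k := u])) y + partial_deriv i (\<lambda>z. b *\<^sub>R \<omega> c z (ws[k := w])) y"
          by (rule partial_deriv_add[OF smooth_on_scaleR[OF V smooth_on_const[OF V] su]
                smooth_on_scaleR[OF V smooth_on_const[OF V] sw] i cy(2)])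
        finally show ?thesis
          by (simp only: partial_deriv_linear[OF bounded_linear_scaleR_right su i cy(2)]
              partial_deriv_linear[OF bounded_linear_scaleR_right sw i cy(2)])
      qed
      then show "?F v (ws[k := \<lambda>i. a * u i + b * w i]) = a *\<^sub>R ?F v (ws[k := u]) + b *\<^sub>R ?F v (ws[k := w])"
        unfolding scaleR_sum_right sum.distrib[symmetric]
        by (intro sum.cong refl) (simp only: lessThan_iff scaleR_add_right scaleR_left_commute)
    next
      fix ws :: "(nat \<Rightarrow> real) list" assume "\<not> (length ws = p \<and> set ws \<subseteq> Rn n)"
      then show "?F v ws = 0" by (simp only: local_form_outside[OF \<omega>] partial_deriv_zero scaleR_zero_right sum.neutral_const simp_thms)
    next
      fix ws :: "(nat \<Rightarrow> real) list" and j k assume "length ws = p" "j < k" "k < p" "ws ! j = ws ! k"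
      then show "?F v ws = 0"
        by (simp only: local_form_equal_entries[OF \<omega>] partial_deriv_zero scaleR_zero_right sum.neutral_const)
    qed
  next
    show "?F (\<lambda>i. a * u i + b * v i) ws = a *\<^sub>R ?F u ws + b *\<^sub>R ?F v ws" for u v :: "nat \<Rightarrow> real" and a b ws
      by (simp add: scaleR_sum_right scaleR_add_left sum.distrib)
    fix vs :: "(nat \<Rightarrow> real) list"
    show "ext_deriv M \<omega> c y vs = (\<Sum>k<Suc p. (-1) ^ k *\<^sub>R ?F (vs ! k) (remove_nth k vs))"
      if "length vs = Suc p" "set vs \<subseteq> Rn n"
      using that cy by (simp add: ext_deriv_def)
    assume vs: "\<not> (length vs = Suc p \<and> set vs \<subseteq> Rn n)"
    show "ext_deriv M \<omega> c y vs = 0"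
    proof (cases "set vs \<subseteq> Rn n")
      case True
      have "?F (vs ! k) (remove_nth k vs) = 0" if "k < length vs" for k
      proof -
        have "\<not> (length (remove_nth k vs) = p \<and> set (remove_nth k vs) \<subseteq> Rn n)"
          using vs True that by (auto simp: length_remove_nth)
        then show ?thesis
          by (simp only: local_form_outside[OF \<omega>] partial_deriv_zero scaleR_zero_right sum.neutral_const simp_thms)
      qed
      then have "(\<Sum>k<length vs. (-1) ^ k *\<^sub>R ?F (vs ! k) (remove_nth k vs)) = 0"
        by (intro sum.neutral ballI) (simp only: lessThan_iff scaleR_zero_right)
      then show ?thesis by (simp add: ext_deriv_def)
    qed (simp add: ext_deriv_def)
  qed
next
  fix c vs assume c: "c \<in> atlas M" and vs: "set vs \<subseteq> Rn n"
  note V = chart_image_open[OF c]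
  have "smooth_on n (chart_image c) (\<lambda>y. \<Sum>k<length vs. (-1) ^ k *\<^sub>R
      (\<Sum>i<n. (vs ! k) i *\<^sub>R partial_deriv i (\<lambda>z. \<omega> c z (remove_nth k vs)) y))"
    by (intro smooth_on_sum[OF V] smooth_on_scaleR[OF V] smooth_on_const[OF V] smooth_on_partial_deriv
        local_formsD(3)[OF \<omega> c] set_remove_nth[OF vs]) simp
  then show "smooth_on n (chart_image c) (\<lambda>y. ext_deriv M \<omega> c y vs)"
    by (rule smooth_on_cong[OF V, rotated]) (simp add: ext_deriv_def c vs)
qed

end

section \<open>The Hodge star and the magnetic operators\<close>

lemma minus_one_power_add_even: "even k \<Longrightarrow> (-1 :: real) ^ (j + k) = (-1) ^ j"
  by (simp add: power_add)

context oriented_riemannian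
begin

lemma hodge_hodge:
  assumes \<omega>: "\<omega> \<in> local_forms M p" and p: "p \<le> n"
  shows "hodge M (n - p) (hodge M p \<omega>) = (\<lambda>c y vs. (-1) ^ (p * (n - p)) *\<^sub>R \<omega> c y vs)"
proof (intro ext)
  fix c y vs
  show "hodge M (n - p) (hodge M p \<omega>) c y vs = (-1) ^ (p * (n - p)) *\<^sub>R \<omega> c y vs"
  proof (cases "c \<in> atlas M \<and> y \<in> chart_image c")
    case True
    then have cy: "c \<in> atlas M" "y \<in> chart_image c" by simp_all
    show ?thesis
      unfolding hodge_eq_star[OF cy]
      by (rule oriented_inner_product.star_star[OF oriented_inner_product_at[OF cy] local_formsD(2)[OF \<omega> cy] p])
  next
    case False
    then show ?thesis by (simp only: hodge_outside_charts local_formsD(1)[OF \<omega>] scaleR_zero_right simp_thms)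
  qed
qed

lemma sharp_eq_raise:
  assumes "c \<in> atlas M" "y \<in> chart_image c"
  shows "sharp M \<alpha> c y = oriented_inner_product.raise n (metric M c y) (\<lambda>w. \<alpha> c y [w])"
  by (simp only: sharp_def sharp_covector_eq_raise[OF assms])

lemma hodge_wedge1:
  fixes \<omega> :: "('a, 'b::real_normed_vector) form"
  assumes \<alpha>: "\<alpha> \<in> local_forms M 1" and \<omega>: "\<omega> \<in> local_forms M p"
  shows "hodge M (Suc p) (wedge1 \<alpha> \<omega>) = (\<lambda>c y vs. (-1) ^ p *\<^sub>R interior (sharp M \<alpha>) (hodge M p \<omega>) c y vs)"
proof (intro ext)
  fix c y vs
  show "hodge M (Suc p) (wedge1 \<alpha> \<omega>) c y vs = (-1) ^ p *\<^sub>R interior (sharp M \<alpha>) (hodge M p \<omega>) c y vs"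
  proof (cases "c \<in> atlas M \<and> y \<in> chart_image c")
    case True
    then have cy: "c \<in> atlas M" "y \<in> chart_image c" by simp_all
    show ?thesis
      unfolding interior_def hodge_eq_star[OF cy] wedge1_eq_covector_wedge sharp_eq_raise[OF cy]
      by (rule oriented_inner_product.star_wedge[OF oriented_inner_product_at[OF cy]
            covector_of_form[OF local_formsD(2)[OF \<alpha> cy]] local_formsD(2)[OF \<omega> cy]])
  next
    case False
    then show ?thesis by (simp only: interior_def hodge_outside_charts scaleR_zero_right simp_thms)
  qed
qed

text \<open>\<open>star_interior\<close> for the vector \<open>X = \<alpha>\<^sup>\<sharp>\<close>, for which \<open>X\<^sup>\<flat> = \<alpha>\<close>; the
  factor \<open>(-1)\<^sup>p\<close> is its own inverse.\<close>

lemma wedge1_hodge: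
  fixes \<omega> :: "('a, 'b::real_normed_vector) form"
  assumes \<alpha>: "\<alpha> \<in> local_forms M 1" and \<omega>: "\<omega> \<in> local_forms M (Suc p)" and p: "Suc p \<le> n"
  shows "wedge1 \<alpha> (hodge M (Suc p) \<omega>) = (\<lambda>c y vs. (-1) ^ p *\<^sub>R hodge M p (interior (sharp M \<alpha>) \<omega>) c y vs)"
proof (intro ext)
  fix c y vs
  have star: "hodge M (Suc p) \<omega> \<in> local_forms M (n - Suc p)"
    using p by (intro hodge_local_form[OF \<omega>]) simp
  show "wedge1 \<alpha> (hodge M (Suc p) \<omega>) c y vs = (-1) ^ p *\<^sub>R hodge M p (interior (sharp M \<alpha>) \<omega>) c y vs"
  proof (cases "c \<in> atlas M \<and> y \<in> chart_image c")
    case True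
    then have cy: "c \<in> atlas M" "y \<in> chart_image c" by simp_all
    interpret pt: oriented_inner_product n "metric M c y" "orient M c y"
      by (rule oriented_inner_product_at[OF cy])
    let ?a = "\<lambda>w. \<alpha> c y [w]"
    have a: "covector n ?a" by (rule covector_of_form[OF local_formsD(2)[OF \<alpha> cy]])
    have flat: "pt.flat (pt.raise ?a) = ?a"
    proof
      fix w
      show "pt.flat (pt.raise ?a) w = ?a w"
        using pt.inner_product_raise[OF a, of w] a by (simp add: pt.flat_def covector_iff)
    qed
    show ?thesis
    proof (cases "set vs \<subseteq> Rn n \<and> p + length vs = n")
      case True
      have "pt.star p (\<lambda>us. \<omega> c y (pt.raise ?a # us)) vs =
          (-1) ^ p *\<^sub>R covector_wedge ?a (pt.star (Suc p) (\<omega> c y)) vs"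
        using pt.star_interior[OF pt.raise_in_Rn[OF a] local_formsD(2)[OF \<omega> cy], of vs] True by (simp only: flat simp_thms)
      then have "(-1) ^ p *\<^sub>R hodge M p (interior (sharp M \<alpha>) \<omega>) c y vs =
          ((-1) ^ p * (-1) ^ p) *\<^sub>R wedge1 \<alpha> (hodge M (Suc p) \<omega>) c y vs"
        unfolding hodge_eq_star[OF cy] wedge1_eq_covector_wedge interior_def sharp_eq_raise[OF cy] by simp
      then show ?thesis by (simp flip: power_add)
    next
      case False
      have "wedge1 \<alpha> (hodge M (Suc p) \<omega>) c y vs = 0"
        using False p by (intro local_form_outside[OF wedge1_local_form[OF \<alpha> star]]) auto
      then show ?thesis unfolding hodge_eq_star[OF cy] by (simp only: pt.star_outside[OF False] scaleR_zero_right)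
    qed
  next
    case False
    then show ?thesis
      by (simp only: local_formsD(1)[OF wedge1_local_form[OF \<alpha> star]] hodge_outside_charts scaleR_zero_right simp_thms)
  qed
qed

lemma codiff_local_form:
  assumes \<omega>: "\<omega> \<in> local_forms M (Suc p)" and p: "Suc p \<le> n"
  shows "codiff M (Suc p) \<omega> \<in> local_forms M p"
proof -
  have "hodge M (Suc p) \<omega> \<in> local_forms M (n - Suc p)"
    using p by (intro hodge_local_form[OF \<omega>]) simp
  from ext_deriv_local_form[OF this] have "hodge M (n - Suc p + 1) (ext_deriv M (hodge M (Suc p) \<omega>)) \<in> local_forms M p"
    using p by (intro hodge_local_form) simp_all
  then show ?thesis unfolding codiff_def by (rule local_form_scaleR)
qed

lemma codiff_scaleR:
  assumes \<omega>: "\<omega> \<in> local_forms M p" and p: "p \<le> n"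
  shows "codiff M p (\<lambda>c y vs. r *\<^sub>R \<omega> c y vs) = (\<lambda>c y vs. r *\<^sub>R codiff M p \<omega> c y vs)"
proof -
  have "hodge M p \<omega> \<in> local_forms M (n - p)"
    using p by (intro hodge_local_form[OF \<omega>]) simp
  then show ?thesis
    unfolding codiff_def hodge_scaleR by (simp only: ext_deriv_scaleR hodge_scaleR scaleR_left_commute[of r])
qed

lemma codiff_of_function: "codiff M 0 \<omega> = (\<lambda>_ _ _. 0)"
  unfolding codiff_def by (simp add: hodge_above_dimension)

lemma codiff_zero: "codiff M p (\<lambda>_ _ _. 0) = (\<lambda>_ _ _. 0)"
  unfolding codiff_def by (simp add: hodge_zero ext_deriv_zero)

text \<open>In \<open>\<delta>(*\<omega>) = \<plusminus> * d ** \<omega>\<close> the two inner stars cancel up to sign. For n = p + q the total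
  exponent differs from p + 1 by \<open>q (q + 1)\<close> and a multiple of 2, hence by an even number.\<close>

lemma codiff_hodge:
  assumes \<omega>: "\<omega> \<in> local_forms M p" and p: "p \<le> n"
  shows "codiff M (n - p) (hodge M p \<omega>) = (\<lambda>c y vs. (-1) ^ Suc p *\<^sub>R hodge M (Suc p) (ext_deriv M \<omega>) c y vs)"
proof -
  have sign: "(-1 :: real) ^ (n * (n - p + 1) + 1) * (-1) ^ (p * (n - p)) = (-1) ^ Suc p"
  proof -
    obtain q where q: "n = p + q" using p by (auto simp: le_iff_add)
    have "n * (n - p + 1) + 1 + p * (n - p) = Suc p + (q * (q + 1) + 2 * (p * q))"
      unfolding q by (simp add: algebra_simps)
    then show ?thesis unfolding power_add[symmetric] by (simp only:) (rule minus_one_power_add_even, simp)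
  qed
  have deg: "n - (n - p) + 1 = Suc p" using p by simp
  show ?thesis
    unfolding codiff_def hodge_hodge[OF \<omega> p] ext_deriv_scaleR[OF \<omega>] hodge_scaleR deg scaleR_scaleR sign ..
qed

text \<open>In \<open>*(\<delta>\<omega>) = \<plusminus> ** d * \<omega>\<close> the two outer stars cancel up to sign. For n = p + q the total
  exponent differs from p + 1 by \<open>p (p + 1)\<close> and a multiple of 2.\<close>

lemma hodge_codiff:
  assumes \<omega>: "\<omega> \<in> local_forms M (Suc p)" and p: "Suc p \<le> n"
  shows "hodge M p (codiff M (Suc p) \<omega>) = (\<lambda>c y vs. (-1) ^ Suc p *\<^sub>R ext_deriv M (hodge M (Suc p) \<omega>) c y vs)"
proof -
  have sign: "(-1 :: real) ^ (n * (Suc p + 1) + 1) * (-1) ^ ((n - p) * p) = (-1) ^ Suc p"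
  proof -
    obtain q where q: "n = p + q" using p by (metis le_iff_add Suc_leD)
    have "n * (Suc p + 1) + 1 + (n - p) * p = Suc p + (p * (p + 1) + 2 * (q + p * q))"
      unfolding q by (simp add: algebra_simps)
    then show ?thesis unfolding power_add[symmetric] by (simp only:) (rule minus_one_power_add_even, simp)
  qed
  have deg: "n - Suc p + 1 = n - p" "n - (n - p) = p" using p by simp_all
  have "hodge M (Suc p) \<omega> \<in> local_forms M (n - Suc p)"
    using p by (intro hodge_local_form[OF \<omega>]) simp
  from ext_deriv_local_form[OF this] have "ext_deriv M (hodge M (Suc p) \<omega>) \<in> local_forms M (n - p)"
    using p by (simp add: Suc_diff_Suc)
  from hodge_hodge[OF this] have hh: "hodge M p (hodge M (n - p) (ext_deriv M (hodge M (Suc p) \<omega>))) =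
      (\<lambda>c y vs. (-1) ^ ((n - p) * p) *\<^sub>R ext_deriv M (hodge M (Suc p) \<omega>) c y vs)"
    by (simp add: deg)
  show ?thesis
    unfolding codiff_def hodge_scaleR deg(1) hh scaleR_scaleR sign ..
qed

context
  fixes \<alpha> :: "('a, real) form"
  assumes \<alpha>: "\<alpha> \<in> local_forms M 1"
begin

lemma magnetic_d_local_form:
  assumes \<omega>: "\<omega> \<in> local_forms M p"
  shows "magnetic_d M \<alpha> \<omega> \<in> local_forms M (Suc p)"
  unfolding magnetic_d_def
  by (intro local_form_add local_form_cmult ext_deriv_local_form[OF \<omega>] wedge1_local_form[OF \<alpha> \<omega>])

lemma magnetic_codiff_local_form:
  assumes \<omega>: "\<omega> \<in> local_forms M (Suc p)" and p: "Suc p \<le> n"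
  shows "magnetic_codiff M \<alpha> (Suc p) \<omega> \<in> local_forms M p"
proof -
  have "(\<lambda>c y vs. codiff M (Suc p) \<omega> c y vs + (-\<i>) * interior (sharp M \<alpha>) \<omega> c y vs) \<in> local_forms M p"
    by (intro local_form_add local_form_cmult codiff_local_form[OF \<omega> p] interior_sharp_local_form[OF \<alpha> \<omega>])
  then show ?thesis unfolding magnetic_codiff_def by simp
qed

lemma magnetic_d_scaleR:
  assumes \<omega>: "\<omega> \<in> local_forms M p"
  shows "magnetic_d M \<alpha> (\<lambda>c y vs. r *\<^sub>R \<omega> c y vs) = (\<lambda>c y vs. r *\<^sub>R magnetic_d M \<alpha> \<omega> c y vs)"
proof -
  have "wedge1 \<alpha> (\<lambda>c y vs. r *\<^sub>R \<omega> c y vs) = (\<lambda>c y vs. r *\<^sub>R wedge1 \<alpha> \<omega> c y vs)"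
    unfolding wedge1_def scaleR_sum_right by (simp only: scaleR_left_commute[of r])
  then show ?thesis
    unfolding magnetic_d_def ext_deriv_scaleR[OF \<omega>] by (simp add: scaleR_add_right)
qed

lemma magnetic_codiff_scaleR:
  assumes \<omega>: "\<omega> \<in> local_forms M p" and p: "p \<le> n"
  shows "magnetic_codiff M \<alpha> p (\<lambda>c y vs. r *\<^sub>R \<omega> c y vs) = (\<lambda>c y vs. r *\<^sub>R magnetic_codiff M \<alpha> p \<omega> c y vs)"
  unfolding magnetic_codiff_def codiff_scaleR[OF \<omega> p] interior_def by (simp add: scaleR_diff_right)

lemma magnetic_d_zero: "magnetic_d M \<alpha> (\<lambda>_ _ _. 0) = (\<lambda>_ _ _. 0)"
  by (simp add: magnetic_d_def ext_deriv_zero wedge1_def)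

lemma magnetic_codiff_zero: "magnetic_codiff M \<alpha> p (\<lambda>_ _ _. 0) = (\<lambda>_ _ _. 0)"
  by (simp add: magnetic_codiff_def codiff_zero interior_def)

lemma magnetic_codiff_of_function: "\<omega> \<in> local_forms M 0 \<Longrightarrow> magnetic_codiff M \<alpha> 0 \<omega> = (\<lambda>_ _ _. 0)"
  by (simp add: magnetic_codiff_def codiff_of_function interior_of_function)

text \<open>The sign \<open>(-1)\<^sup>p\<^sup>+\<^sup>1\<close> of \<open>codiff_hodge\<close> and the sign \<open>(-1)\<^sup>p\<close> of \<open>hodge_wedge1\<close> are opposite; this
  matches the opposite signs in front of \<open>i\<close> in \<open>d + i \<alpha>\<and>\<close> and \<open>\<delta> - i \<alpha>\<^sup>\<sharp>\<lrcorner>\<close>.\<close>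

lemma magnetic_codiff_hodge:
  assumes \<omega>: "\<omega> \<in> local_forms M p" and p: "p \<le> n"
  shows "magnetic_codiff M \<alpha> (n - p) (hodge M p \<omega>) =
    (\<lambda>c y vs. (-1) ^ Suc p *\<^sub>R hodge M (Suc p) (magnetic_d M \<alpha> \<omega>) c y vs)"
proof -
  have "hodge M (Suc p) (magnetic_d M \<alpha> \<omega>) = (\<lambda>c y vs. hodge M (Suc p) (ext_deriv M \<omega>) c y vs +
      \<i> * (-1) ^ p *\<^sub>R interior (sharp M \<alpha>) (hodge M p \<omega>) c y vs)"
    unfolding magnetic_d_def hodge_add hodge_cmult hodge_wedge1[OF \<alpha> \<omega>] ..
  moreover have "(-1::real) ^ p * (-1) ^ p = 1" by (simp flip: power_add)
  ultimately show ?thesis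
    unfolding magnetic_codiff_def codiff_hodge[OF \<omega> p] by (simp add: scaleR_add_right)
qed

lemma magnetic_d_hodge:
  assumes \<omega>: "\<omega> \<in> local_forms M (Suc p)"
  shows "magnetic_d M \<alpha> (hodge M (Suc p) \<omega>) =
    (\<lambda>c y vs. (-1) ^ Suc p *\<^sub>R hodge M p (magnetic_codiff M \<alpha> (Suc p) \<omega>) c y vs)"
proof (cases "Suc p \<le> n")
  case True
  have sgn: "(-1::real) ^ p * (-1) ^ p = 1" by (simp flip: power_add)
  have "magnetic_codiff M \<alpha> (Suc p) \<omega> =
      (\<lambda>c y vs. codiff M (Suc p) \<omega> c y vs + (-\<i>) * interior (sharp M \<alpha>) \<omega> c y vs)"
    by (simp add: magnetic_codiff_def)
  then have "hodge M p (magnetic_codiff M \<alpha> (Suc p) \<omega>) = (\<lambda>c y vs. (-1) ^ Suc p *\<^sub>R ext_deriv M (hodge M (Suc p) \<omega>) c y vs +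
      (-\<i>) * hodge M p (interior (sharp M \<alpha>) \<omega>) c y vs)"
    by (simp only: hodge_add hodge_cmult hodge_codiff[OF \<omega> True])
  then show ?thesis
    unfolding magnetic_d_def wedge1_hodge[OF \<alpha> \<omega> True] by (simp add: scaleR_diff_right sgn)
next
  case False
  then have "\<omega> = (\<lambda>_ _ _. 0)" by (intro local_form_above_dimension[OF \<omega>]) simp
  then show ?thesis by (simp add: hodge_zero magnetic_d_zero magnetic_codiff_zero)
qed

lemma magnetic_laplacian_hodge:
  assumes \<omega>: "\<omega> \<in> local_forms M p" and p: "p \<le> n"
  shows "magnetic_laplacian M \<alpha> (n - p) (hodge M p \<omega>) = hodge M p (magnetic_laplacian M \<alpha> p \<omega>)"
proof -
  have sgn: "(-1::real) ^ k * (-1) ^ k = 1" for k by (simp flip: power_add)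
  note d\<omega> = magnetic_d_local_form[OF \<omega>]
  \<comment> \<open>the star turns d followed by delta into delta followed by d; above degree n both sides are zero\<close>
  have d_codiff: "magnetic_d M \<alpha> (magnetic_codiff M \<alpha> (n - p) (hodge M p \<omega>)) =
      hodge M p (magnetic_codiff M \<alpha> (Suc p) (magnetic_d M \<alpha> \<omega>))"
  proof (cases "Suc p \<le> n")
    case True
    have "hodge M (Suc p) (magnetic_d M \<alpha> \<omega>) \<in> local_forms M (n - Suc p)"
      using True by (intro hodge_local_form[OF d\<omega>]) simp
    from magnetic_d_scaleR[OF this] show ?thesis
      by (simp only: magnetic_codiff_hodge[OF \<omega> p] magnetic_d_hodge[OF d\<omega>] scaleR_scaleR sgn scaleR_one)
  next
    case False
    then have "magnetic_d M \<alpha> \<omega> = (\<lambda>_ _ _. 0)" by (intro local_form_above_dimension[OF d\<omega>]) simp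
    then show ?thesis
      by (simp add: magnetic_codiff_hodge[OF \<omega> p] hodge_zero magnetic_codiff_zero magnetic_d_zero)
  qed
  \<comment> \<open>the converse exchange; for functions both sides are zero, as delta vanishes on them and d on n-forms\<close>
  have codiff_d: "magnetic_codiff M \<alpha> (n - p + 1) (magnetic_d M \<alpha> (hodge M p \<omega>)) =
      hodge M p (magnetic_d M \<alpha> (magnetic_codiff M \<alpha> p \<omega>))"
  proof (cases p)
    case 0
    have "hodge M p \<omega> \<in> local_forms M n" using 0 by (intro hodge_local_form[OF \<omega>]) simp
    from local_form_above_dimension[OF magnetic_d_local_form[OF this]]
    have "magnetic_d M \<alpha> (hodge M p \<omega>) = (\<lambda>_ _ _. 0)" by simp
    moreover have "magnetic_codiff M \<alpha> p \<omega> = (\<lambda>_ _ _. 0)"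
      using \<omega> unfolding 0 by (rule magnetic_codiff_of_function)
    ultimately show ?thesis by (simp only: magnetic_codiff_zero magnetic_d_zero hodge_zero)
  next
    case (Suc r)
    have r: "Suc r \<le> n" "r \<le> n" and deg: "n - p + 1 = n - r" using p Suc by simp_all
    have \<omega>': "\<omega> \<in> local_forms M (Suc r)" using \<omega> Suc by simp
    note \<delta>\<omega> = magnetic_codiff_local_form[OF \<omega>' r(1)]
    have "hodge M r (magnetic_codiff M \<alpha> (Suc r) \<omega>) \<in> local_forms M (n - r)"
      using r by (intro hodge_local_form[OF \<delta>\<omega>]) simp
    from magnetic_codiff_scaleR[OF this diff_le_self] show ?thesis
      unfolding deg unfolding Suc
      by (simp only: magnetic_d_hodge[OF \<omega>'] magnetic_codiff_hodge[OF \<delta>\<omega> r(2)]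
          scaleR_scaleR sgn scaleR_one)
  qed
  show ?thesis
    unfolding magnetic_laplacian_def d_codiff codiff_d hodge_add by (simp add: add.commute)
qed

end

end

theorem corollary3p2:
  fixes M :: "'a riemannian"
    and \<alpha> :: "('a, real) form"
    and \<omega> :: "('a, complex) form"
    and p :: nat
  assumes "oriented_riemannian_manifold M"
    and "\<alpha> \<in> forms M 1"
    and "p \<le> mdim M"
    and "\<omega> \<in> forms M p"
  shows "magnetic_laplacian M \<alpha> (mdim M - p) (hodge M p \<omega>) =
         hodge M p (magnetic_laplacian M \<alpha> p \<omega>)"
proof -
  interpret oriented_riemannian M by unfold_locales (rule assms(1))
  show ?thesis
    using assms(3) subsetD[OF forms_subset_local_forms assms(2)] subsetD[OF forms_subset_local_forms assms(4)]
    by (intro magnetic_laplacian_hodge)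
qed

end
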